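(* A real completely positive completely contractive map (resp. projection) on an approximately unital operator algebra $A$ extends to a unital (real completely positive) completely contractive map (resp. projection) on the unitization $A^1$. (If $A$ is unital then we define $A^1 = A \oplus^\infty \mathbb{C}$ here.)
   Context: An operator algebra is a norm-closed, not necessarily selfadjoint, subalgebra of $B(H)$ for a Hilbert space $H$, with its inherited operator space structure. It is approximately unital if it has a contractive approximate identity. If $A$ is nonunital and represented completely isometrically on $H$, its unitization $A^1$ is identified with $A + \mathbb{C} I_H$. A map on $A$ is a linear map $A \to A$; a projection on $A$ is a linear idempotent map $A \to A$; a map on a unital algebra is unital if it fixes the identity. Write $\mathfrak{r}_A = \{x \in A : x + x^* \geq 0\}$; a linear map $P$ on $A$ is real completely positive if $P_n(\mathfrak{r}_{M_n(A)}) \subset \mathfrak{r}_{M_n(A)}$ for all $n \in \mathbb{N}$, where $P_n$ is the amplification to $M_n(A)$. *)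

theory Defs
  imports "HOL-Analysis.Analysis"
begin

section \<open>Complex Hilbert spaces\<close>

text \<open>The inner product is conjugate-linear in the first and linear in the second argument.\<close>

class chilbert_space = banach +
  fixes scaleC :: "complex \<Rightarrow> 'a \<Rightarrow> 'a"  (infixr "*\<^sub>C" 75)
    and cinner :: "'a \<Rightarrow> 'a \<Rightarrow> complex"
  assumes scaleC_add_right: "c *\<^sub>C (x + y) = c *\<^sub>C x + c *\<^sub>C y"
    and scaleC_add_left: "(c + d) *\<^sub>C x = c *\<^sub>C x + d *\<^sub>C x"
    and scaleC_scaleC: "c *\<^sub>C (d *\<^sub>C x) = (c * d) *\<^sub>C x"
    and scaleC_of_real: "complex_of_real r *\<^sub>C x = r *\<^sub>R x"
    and cinner_commute: "cinner x y = cnj (cinner y x)"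
    and cinner_add_right: "cinner x (y + z) = cinner x y + cinner x z"
    and cinner_scaleC_right: "cinner x (c *\<^sub>C y) = c * cinner x y"
    and cinner_norm: "cinner x x = complex_of_real ((norm x)\<^sup>2)"

instantiation complex :: chilbert_space
begin

definition scaleC_complex :: "complex \<Rightarrow> complex \<Rightarrow> complex"
  where "scaleC_complex c x = c * x"

definition cinner_complex :: "complex \<Rightarrow> complex \<Rightarrow> complex"
  where "cinner_complex x y = cnj x * y"

instance
  by standard
    (auto simp: scaleC_complex_def cinner_complex_def algebra_simps scaleR_conv_of_real
      complex_norm_square simp flip: of_real_power)

end

instantiation prod :: (chilbert_space, chilbert_space) chilbert_space
begin

definition scaleC_prod :: "complex \<Rightarrow> 'a \<times> 'b \<Rightarrow> 'a \<times> 'b"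
  where "scaleC_prod c x = (c *\<^sub>C fst x, c *\<^sub>C snd x)"

definition cinner_prod :: "'a \<times> 'b \<Rightarrow> 'a \<times> 'b \<Rightarrow> complex"
  where "cinner_prod x y = cinner (fst x) (fst y) + cinner (snd x) (snd y)"

instance
proof
  fix x y z :: "'a \<times> 'b" and c d :: complex and r :: real
  show "c *\<^sub>C (x + y) = c *\<^sub>C x + c *\<^sub>C y" "(c + d) *\<^sub>C x = c *\<^sub>C x + d *\<^sub>C x"
    "c *\<^sub>C (d *\<^sub>C x) = (c * d) *\<^sub>C x"
    by (auto simp: scaleC_prod_def scaleC_add_right scaleC_add_left scaleC_scaleC)
  show "complex_of_real r *\<^sub>C x = r *\<^sub>R x"
    by (auto simp: scaleC_prod_def scaleC_of_real scaleR_prod_def)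
  show "cinner x y = cnj (cinner y x)"
    by (simp add: cinner_prod_def cinner_commute[of "fst x"] cinner_commute[of "snd x"])
  show "cinner x (y + z) = cinner x y + cinner x z" "cinner x (c *\<^sub>C y) = c * cinner x y"
    by (auto simp: cinner_prod_def scaleC_prod_def cinner_add_right cinner_scaleC_right
        algebra_simps)
  show "cinner x x = complex_of_real ((norm x)\<^sup>2)"
    by (simp add: cinner_prod_def cinner_norm norm_prod_def)
qed

end

lemma cinner_add_left: "cinner (x + y) z = cinner x z + cinner y z"
  by (metis cinner_add_right cinner_commute complex_cnj_add)

lemma cinner_scaleC_left: "cinner (c *\<^sub>C x) y = cnj c * cinner x y"
  by (metis cinner_scaleC_right cinner_commute complex_cnj_mult)

lemma cinner_scaleR_right: "cinner x (r *\<^sub>R y) = complex_of_real r * cinner x y"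
  by (metis cinner_scaleC_right scaleC_of_real)

lemma cinner_scaleR_left: "cinner (r *\<^sub>R x) y = complex_of_real r * cinner x y"
  by (metis cinner_scaleC_left scaleC_of_real complex_cnj_complex_of_real)

lemma norm_add_sq: "(norm (x + y))\<^sup>2 = (norm x)\<^sup>2 + 2 * Re (cinner x y) + (norm y)\<^sup>2"
proof -
  have "complex_of_real ((norm (x + y))\<^sup>2) = cinner (x + y) (x + y)"
    by (simp add: cinner_norm)
  also have "\<dots> = cinner x x + (cinner x y + cnj (cinner x y)) + cinner y y"
    by (simp add: cinner_add_left cinner_add_right cinner_commute[of y x])
  finally have "Re (complex_of_real ((norm (x + y))\<^sup>2)) =
      Re (cinner x x + (cinner x y + cnj (cinner x y)) + cinner y y)"
    by simp
  then show ?thesis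
    by (simp add: cinner_norm)
qed

lemma parallelogram:
  fixes x y :: "'a::chilbert_space"
  shows "(norm (x + y))\<^sup>2 + (norm (x - y))\<^sup>2 = 2 * (norm x)\<^sup>2 + 2 * (norm y)\<^sup>2"
proof -
  have "cinner x (- y) = - cinner x y"
    using cinner_scaleR_right[of x "-1" y] by simp
  then show ?thesis
    using norm_add_sq[of x y] norm_add_sq[of x "- y"] by simp
qed

lemma scaleC_zero_right [simp]: "c *\<^sub>C (0::'a::chilbert_space) = 0"
  using scaleC_add_right[of c "0::'a" 0] by simp

lemma norm_scaleC: "norm (c *\<^sub>C x) = cmod c * norm x"
proof -
  have "complex_of_real ((norm (c *\<^sub>C x))\<^sup>2) = complex_of_real ((cmod c * norm x)\<^sup>2)"
    unfolding cinner_norm[symmetric] cinner_scaleC_left cinner_scaleC_right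
    by (simp add: cinner_norm power_mult_distrib complex_norm_square algebra_simps
        del: of_real_power)
  then have "(norm (c *\<^sub>C x))\<^sup>2 = (cmod c * norm x)\<^sup>2"
    by (simp only: of_real_eq_iff)
  then show ?thesis
    by (simp add: power2_eq_iff_nonneg)
qed

lemma bounded_linear_scaleC: "bounded_linear (\<lambda>x. c *\<^sub>C (x::'a::chilbert_space))"
proof (rule bounded_linear_intro)
  show "c *\<^sub>C (r *\<^sub>R x) = r *\<^sub>R (c *\<^sub>C x)" for r and x :: 'a
    unfolding scaleC_of_real[symmetric] by (simp add: scaleC_scaleC mult.commute)
  show "norm (c *\<^sub>C x) \<le> norm x * cmod c" for x :: 'a
    by (simp add: norm_scaleC)
qed (rule scaleC_add_right)

lemma riesz_real:
  fixes f :: "'a::chilbert_space \<Rightarrow> real"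
  assumes "bounded_linear f"
  shows "\<exists>z. \<forall>y. f y = Re (cinner z y)"
proof -
  interpret f: bounded_linear f by fact
  obtain K where K: "\<And>x. \<bar>f x\<bar> \<le> norm x * K"
    using f.bounded by auto
  define J where "J x = (norm x)\<^sup>2 - 2 * f x" for x
  have J_lower: "- K\<^sup>2 \<le> J x" for x
  proof -
    have "0 \<le> (norm x - K)\<^sup>2" by simp
    then show ?thesis
      using K[of x] unfolding J_def power2_diff by (simp add: abs_le_iff)
  qed
  define d where "d = (INF x. J x)"
  have bdd: "bdd_below (range J)"
    using J_lower by (auto intro: bdd_belowI[of _ "- K\<^sup>2"])
  have d_le: "d \<le> J x" for x
    unfolding d_def using bdd by (rule cINF_lower) simp
  have "\<exists>x. J x < d + 1 / real (Suc n)" for n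
    using cInf_lessD[of "range J" "d + 1 / real (Suc n)"] unfolding d_def by auto
  then obtain X where X: "\<And>n. J (X n) < d + 1 / real (Suc n)"
    by metis
  have key: "(norm (x - y))\<^sup>2 \<le> 2 * (J x - d) + 2 * (J y - d)" for x y
  proof -
    have "J ((1/2) *\<^sub>R (x + y)) = (norm (x + y))\<^sup>2 / 4 - (f x + f y)"
      unfolding J_def by (simp only: f.scaleR f.add norm_scaleR) (simp add: power_divide field_simps)
    then have "(norm (x + y))\<^sup>2 = 4 * J ((1/2) *\<^sub>R (x + y)) + 4 * (f x + f y)"
      by simp
    moreover have "(norm x)\<^sup>2 = J x + 2 * f x" "(norm y)\<^sup>2 = J y + 2 * f y"
      by (simp_all add: J_def)
    ultimately show ?thesis
      using parallelogram[of x y] d_le[of "(1/2) *\<^sub>R (x + y)"] by simp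
  qed
  have "Cauchy X"
  proof (rule metric_CauchyI)
    fix e :: real assume e: "e > 0"
    obtain N where N: "1 / real (Suc N) < e\<^sup>2 / 4"
      using e by (metis nat_approx_posE divide_pos_pos zero_less_numeral zero_less_power)
    have "dist (X m) (X n) < e" if "m \<ge> N" "n \<ge> N" for m n
    proof -
      have small: "J (X k) < d + e\<^sup>2 / 4" if "k \<ge> N" for k
      proof -
        have "1 / real (Suc k) \<le> 1 / real (Suc N)"
          using that by (intro divide_left_mono) auto
        then have "1 / real (Suc k) < e\<^sup>2 / 4"
          using N by (rule order_le_less_trans)
        then show ?thesis
          using X[of k] by (meson add_left_mono less_imp_le less_le_trans)
      qed
      have "(norm (X m - X n))\<^sup>2 < e\<^sup>2"
        using key[of "X m" "X n"] small[OF that(1)] small[OF that(2)]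
        by (simp add: algebra_simps)
      then show ?thesis
        using e by (simp add: dist_norm power2_less_imp_less)
    qed
    then show "\<exists>N. \<forall>m\<ge>N. \<forall>n\<ge>N. dist (X m) (X n) < e" by blast
  qed
  then obtain z where z: "X \<longlonglongrightarrow> z"
    using convergentD Cauchy_convergent by blast
  have "(\<lambda>n. J (X n)) \<longlonglongrightarrow> J z"
    unfolding J_def using z f.tendsto[OF z] by (intro tendsto_intros)
  moreover have "(\<lambda>n. d + 1 / real (Suc n)) \<longlonglongrightarrow> d + 0"
    by (rule tendsto_add[OF tendsto_const LIMSEQ_Suc[OF lim_1_over_n]])
  ultimately have "J z \<le> d"
    using LIMSEQ_le[of "\<lambda>n. J (X n)" "J z" "\<lambda>n. d + 1 / real (Suc n)" "d + 0"] X
    by (auto intro: less_imp_le)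
  then have min: "J z \<le> J x" for x
    using d_le[of x] by linarith
  have "f y = Re (cinner z y)" for y
  proof -
    define b where "b = 2 * (Re (cinner z y) - f y)"
    have ineq: "0 \<le> t * b + t\<^sup>2 * (norm y)\<^sup>2" for t
    proof -
      have "J (z + t *\<^sub>R y) = J z + t * b + t\<^sup>2 * (norm y)\<^sup>2"
        unfolding J_def b_def norm_add_sq
        by (simp add: f.add f.scaleR cinner_scaleR_right power_mult_distrib algebra_simps)
      then show ?thesis using min[of "z + t *\<^sub>R y"] by simp
    qed
    have "b = 0"
    proof (rule ccontr)
      assume "b \<noteq> 0"
      define k where "k = (norm y)\<^sup>2 + 1"
      have k: "k > 0" by (simp add: k_def add_nonneg_pos)
      have y: "(norm y)\<^sup>2 = k - 1" by (simp add: k_def)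
      have "(- b / k) * b + (- b / k)\<^sup>2 * (norm y)\<^sup>2 = - (b\<^sup>2 / k\<^sup>2)"
        unfolding y using k by (simp add: field_simps power2_eq_square)
      moreover have "b\<^sup>2 / k\<^sup>2 > 0"
        using \<open>b \<noteq> 0\<close> k by simp
      ultimately show False using ineq[of "- b / k"] by linarith
    qed
    then show ?thesis by (simp add: b_def)
  qed
  then show ?thesis by blast
qed


section \<open>Operators and their adjoints\<close>

text \<open>Elements of \<open>'h \<Rightarrow>\<^sub>L 'h\<close> are only real-linear, so \<open>B(H)\<close> is a proper subset of this type.\<close>

definition bounded_operators :: "('h::chilbert_space \<Rightarrow>\<^sub>L 'h) set"
  where "bounded_operators =
    {T. \<forall>c x. blinfun_apply T (c *\<^sub>C x) = c *\<^sub>C blinfun_apply T x}"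

lift_definition op_scaleC ::
    "complex \<Rightarrow> ('h::chilbert_space \<Rightarrow>\<^sub>L 'h) \<Rightarrow> 'h \<Rightarrow>\<^sub>L 'h"
  is "\<lambda>c T x. c *\<^sub>C T x"
  by (rule bounded_linear_compose[OF bounded_linear_scaleC])

definition op_adjoint :: "('h::chilbert_space \<Rightarrow>\<^sub>L 'h) \<Rightarrow> 'h \<Rightarrow>\<^sub>L 'h"
  where "op_adjoint T =
    (THE S. \<forall>x y. cinner (blinfun_apply S x) y = cinner x (blinfun_apply T y))"

lemma cinner_ext:
  fixes u v :: "'h::chilbert_space"
  assumes "\<And>y. cinner u y = cinner v y"
  shows "u = v"
proof -
  have "cinner (u - v) y = 0" for y
    using cinner_add_left[of "u - v" v y] assms[of y] by simp
  then show ?thesis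
    using cinner_norm[of "u - v"] by simp
qed

lemma op_adjoint_exists:
  fixes T :: "'h::chilbert_space \<Rightarrow>\<^sub>L 'h"
  assumes "T \<in> bounded_operators"
  shows "\<exists>!S. \<forall>x y. cinner (blinfun_apply S x) y = cinner x (blinfun_apply T y)"
proof -
  have T: "blinfun_apply T (c *\<^sub>C y) = c *\<^sub>C blinfun_apply T y" for c y
    using assms by (simp add: bounded_operators_def)
  have CS: "\<bar>Re (cinner x y)\<bar> \<le> norm x * norm y" for x y :: 'h
  proof -
    have half: "Re (cinner x y) \<le> norm x * norm y" for x y :: 'h
    proof -
      have "(norm (x + y))\<^sup>2 \<le> (norm x + norm y)\<^sup>2"
        by (simp add: norm_triangle_ineq power_mono)
      then show ?thesis unfolding norm_add_sq power2_sum by simp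
    qed
    have "cinner x (- y) = - cinner x y"
      using cinner_scaleR_right[of x "-1" y] by simp
    then show ?thesis using half[of x y] half[of x "- y"] by (simp add: abs_le_iff)
  qed
  have "\<exists>z. \<forall>y. cinner z y = cinner x (blinfun_apply T y)" for x
  proof -
    have "bounded_linear (\<lambda>y. Re (cinner x (blinfun_apply T y)))"
    proof (rule bounded_linear_intro)
      show "norm (Re (cinner x (blinfun_apply T y))) \<le> norm y * (norm x * norm T)" for y
        using CS[of x "blinfun_apply T y"] mult_left_mono[OF norm_blinfun[of T y] norm_ge_zero[of x]]
        by (simp add: algebra_simps)
    qed (auto simp: blinfun.bilinear_simps cinner_add_right cinner_scaleR_right)
    then obtain z where z: "\<And>y. Re (cinner x (blinfun_apply T y)) = Re (cinner z y)"
      using riesz_real by blast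
    have "Im (cinner x (blinfun_apply T y)) = Im (cinner z y)" for y
      using z[of "\<i> *\<^sub>C y"] by (simp add: T cinner_scaleC_right)
    with z show ?thesis by (metis complex_eqI)
  qed
  then obtain S where S: "\<And>x y. cinner (S x) y = cinner x (blinfun_apply T y)"
    by metis
  have "bounded_linear S"
  proof (rule bounded_linear_intro)
    show "S (x + y) = S x + S y" for x y
      by (rule cinner_ext) (simp add: S cinner_add_left)
    show "S (r *\<^sub>R x) = r *\<^sub>R S x" for r x
      by (rule cinner_ext) (simp add: S cinner_scaleR_left)
    show "norm (S x) \<le> norm x * norm T" for x
    proof -
      have "(norm (S x))\<^sup>2 = Re (cinner x (blinfun_apply T (S x)))"
        using arg_cong[OF S[of x "S x"], of Re] by (simp only: cinner_norm Re_complex_of_real)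
      also have "\<dots> \<le> norm x * (norm T * norm (S x))"
        using CS[of x "blinfun_apply T (S x)"]
          mult_left_mono[OF norm_blinfun[of T "S x"] norm_ge_zero[of x]]
        by (simp add: abs_le_iff)
      finally have "norm (S x) * norm (S x) \<le> (norm x * norm T) * norm (S x)"
        by (simp add: power2_eq_square algebra_simps)
      then show ?thesis
        by (cases "norm (S x) = 0") (auto dest: mult_right_le_imp_le)
    qed
  qed
  then have "\<forall>x y. cinner (blinfun_apply (Blinfun S) x) y = cinner x (blinfun_apply T y)"
    by (simp add: bounded_linear_Blinfun_apply S)
  moreover have "S1 = S2"
    if "\<forall>x y. cinner (blinfun_apply S1 x) y = cinner x (blinfun_apply T y)"
      "\<forall>x y. cinner (blinfun_apply S2 x) y = cinner x (blinfun_apply T y)" for S1 S2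
  proof (rule blinfun_eqI, rule cinner_ext)
    show "cinner (blinfun_apply S1 x) y = cinner (blinfun_apply S2 x) y" for x y
      using that by simp
  qed
  ultimately show ?thesis by blast
qed

lemma op_adjoint_works:
  assumes "T \<in> bounded_operators"
  shows "cinner (blinfun_apply (op_adjoint T) x) y = cinner x (blinfun_apply T y)"
  using theI'[OF op_adjoint_exists[OF assms]] unfolding op_adjoint_def by blast


section \<open>Operator algebras\<close>

definition operator_algebra :: "('h::chilbert_space \<Rightarrow>\<^sub>L 'h) set \<Rightarrow> bool"
  where "operator_algebra A \<longleftrightarrow>
    A \<subseteq> bounded_operators \<and> closed A \<and> 0 \<in> A \<and>
    (\<forall>a\<in>A. \<forall>b\<in>A. a + b \<in> A) \<and>
    (\<forall>c. \<forall>a\<in>A. op_scaleC c a \<in> A) \<and>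
    (\<forall>a\<in>A. \<forall>b\<in>A. a o\<^sub>L b \<in> A)"

text \<open>A net in \<open>A\<close> is represented by its filter of tails, a proper filter on \<open>A\<close>; conversely
  every proper filter is the filter of tails of a net.\<close>

definition approximately_unital :: "('h::chilbert_space \<Rightarrow>\<^sub>L 'h) set \<Rightarrow> bool"
  where "approximately_unital A \<longleftrightarrow>
    (\<exists>F. F \<noteq> bot \<and> eventually (\<lambda>e. e \<in> A \<and> norm e \<le> 1) F \<and>
      (\<forall>a\<in>A. ((\<lambda>e. e o\<^sub>L a) \<longlongrightarrow> a) F \<and> ((\<lambda>e. a o\<^sub>L e) \<longlongrightarrow> a) F))"

definition is_identity ::
    "('h::chilbert_space \<Rightarrow>\<^sub>L 'h) set \<Rightarrow> ('h \<Rightarrow>\<^sub>L 'h) \<Rightarrow> bool"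
  where "is_identity A e \<longleftrightarrow> e \<in> A \<and> (\<forall>a\<in>A. e o\<^sub>L a = a \<and> a o\<^sub>L e = a)"

text \<open>The identity of \<open>A\<close> need not be the identity operator on the Hilbert space.\<close>

definition unital_algebra :: "('h::chilbert_space \<Rightarrow>\<^sub>L 'h) set \<Rightarrow> bool"
  where "unital_algebra A \<longleftrightarrow> (\<exists>e. is_identity A e)"


section \<open>Matrices over an operator algebra\<close>

text \<open>An \<open>n \<times> n\<close> matrix is a function of two indices of which only the values at indices
  \<open>< n\<close> matter. It acts on the \<open>n\<close>-fold Hilbert space direct sum of \<open>H\<close>, whose vectors are
  represented in the same way by functions of one index.\<close>

definition matrices ::
    "nat \<Rightarrow> ('h::chilbert_space \<Rightarrow>\<^sub>L 'h) set \<Rightarrow> (nat \<Rightarrow> nat \<Rightarrow> 'h \<Rightarrow>\<^sub>L 'h) set"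
  where "matrices n A = {X. \<forall>i<n. \<forall>j<n. X i j \<in> A}"

definition mat_apply ::
    "nat \<Rightarrow> (nat \<Rightarrow> nat \<Rightarrow> 'h::chilbert_space \<Rightarrow>\<^sub>L 'h) \<Rightarrow> (nat \<Rightarrow> 'h) \<Rightarrow> nat \<Rightarrow> 'h"
  where "mat_apply n X v i = (\<Sum>j<n. blinfun_apply (X i j) (v j))"

definition vec_norm :: "nat \<Rightarrow> (nat \<Rightarrow> 'h::chilbert_space) \<Rightarrow> real"
  where "vec_norm n v = sqrt (\<Sum>i<n. (norm (v i))\<^sup>2)"

definition vec_cinner :: "nat \<Rightarrow> (nat \<Rightarrow> 'h::chilbert_space) \<Rightarrow> (nat \<Rightarrow> 'h) \<Rightarrow> complex"
  where "vec_cinner n v w = (\<Sum>i<n. cinner (v i) (w i))"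

definition mat_norm :: "nat \<Rightarrow> (nat \<Rightarrow> nat \<Rightarrow> 'h::chilbert_space \<Rightarrow>\<^sub>L 'h) \<Rightarrow> real"
  where "mat_norm n X = (SUP v\<in>{v. vec_norm n v \<le> 1}. vec_norm n (mat_apply n X v))"

definition mat_plus ::
    "(nat \<Rightarrow> nat \<Rightarrow> 'h::chilbert_space \<Rightarrow>\<^sub>L 'h) \<Rightarrow> (nat \<Rightarrow> nat \<Rightarrow> 'h \<Rightarrow>\<^sub>L 'h) \<Rightarrow>
      nat \<Rightarrow> nat \<Rightarrow> 'h \<Rightarrow>\<^sub>L 'h"
  where "mat_plus X Y i j = X i j + Y i j"

definition mat_adjoint ::
    "(nat \<Rightarrow> nat \<Rightarrow> 'h::chilbert_space \<Rightarrow>\<^sub>L 'h) \<Rightarrow> nat \<Rightarrow> nat \<Rightarrow> 'h \<Rightarrow>\<^sub>L 'h"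
  where "mat_adjoint X i j = op_adjoint (X j i)"

definition mat_positive :: "nat \<Rightarrow> (nat \<Rightarrow> nat \<Rightarrow> 'h::chilbert_space \<Rightarrow>\<^sub>L 'h) \<Rightarrow> bool"
  where "mat_positive n X \<longleftrightarrow> (\<forall>v. vec_cinner n v (mat_apply n X v) \<in> \<real>\<^sub>\<ge>\<^sub>0)"

text \<open>\<open>real_positive n A\<close> is the set of all \<open>X \<in> M\<^sub>n(A)\<close> with \<open>X + X* \<ge> 0\<close>.\<close>

definition real_positive ::
    "nat \<Rightarrow> ('h::chilbert_space \<Rightarrow>\<^sub>L 'h) set \<Rightarrow> (nat \<Rightarrow> nat \<Rightarrow> 'h \<Rightarrow>\<^sub>L 'h) set"
  where "real_positive n A =
    {X \<in> matrices n A. mat_positive n (mat_plus X (mat_adjoint X))}"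


section \<open>Maps on an operator algebra\<close>

text \<open>A map on \<open>A\<close> is given by a HOL function; its values outside \<open>A\<close> are irrelevant.\<close>

definition map_on ::
    "('h::chilbert_space \<Rightarrow>\<^sub>L 'h) set \<Rightarrow> (('h \<Rightarrow>\<^sub>L 'h) \<Rightarrow> 'h \<Rightarrow>\<^sub>L 'h) \<Rightarrow> bool"
  where "map_on A P \<longleftrightarrow>
    (\<forall>a\<in>A. P a \<in> A) \<and>
    (\<forall>a\<in>A. \<forall>b\<in>A. P (a + b) = P a + P b) \<and>
    (\<forall>c. \<forall>a\<in>A. P (op_scaleC c a) = op_scaleC c (P a))"

definition projection_on ::
    "('h::chilbert_space \<Rightarrow>\<^sub>L 'h) set \<Rightarrow> (('h \<Rightarrow>\<^sub>L 'h) \<Rightarrow> 'h \<Rightarrow>\<^sub>L 'h) \<Rightarrow> bool"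
  where "projection_on A P \<longleftrightarrow> map_on A P \<and> (\<forall>a\<in>A. P (P a) = P a)"

definition unital_on ::
    "('h::chilbert_space \<Rightarrow>\<^sub>L 'h) set \<Rightarrow> (('h \<Rightarrow>\<^sub>L 'h) \<Rightarrow> 'h \<Rightarrow>\<^sub>L 'h) \<Rightarrow> bool"
  where "unital_on A P \<longleftrightarrow> (\<exists>e. is_identity A e \<and> P e = e)"

definition amplification ::
    "(('h::chilbert_space \<Rightarrow>\<^sub>L 'h) \<Rightarrow> 'h \<Rightarrow>\<^sub>L 'h) \<Rightarrow>
      (nat \<Rightarrow> nat \<Rightarrow> 'h \<Rightarrow>\<^sub>L 'h) \<Rightarrow> nat \<Rightarrow> nat \<Rightarrow> 'h \<Rightarrow>\<^sub>L 'h"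
  where "amplification P X i j = P (X i j)"

definition completely_contractive ::
    "('h::chilbert_space \<Rightarrow>\<^sub>L 'h) set \<Rightarrow> (('h \<Rightarrow>\<^sub>L 'h) \<Rightarrow> 'h \<Rightarrow>\<^sub>L 'h) \<Rightarrow> bool"
  where "completely_contractive A P \<longleftrightarrow>
    (\<forall>n. \<forall>X\<in>matrices n A. mat_norm n (amplification P X) \<le> mat_norm n X)"

definition real_completely_positive ::
    "('h::chilbert_space \<Rightarrow>\<^sub>L 'h) set \<Rightarrow> (('h \<Rightarrow>\<^sub>L 'h) \<Rightarrow> 'h \<Rightarrow>\<^sub>L 'h) \<Rightarrow> bool"
  where "real_completely_positive A P \<longleftrightarrow>
    (\<forall>n. amplification P ` real_positive n A \<subseteq> real_positive n A)"


section \<open>Unitizations\<close>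

definition unitization :: "('h::chilbert_space \<Rightarrow>\<^sub>L 'h) set \<Rightarrow> ('h \<Rightarrow>\<^sub>L 'h) set"
  where "unitization A = {a + op_scaleC c id_blinfun | a c. a \<in> A}"

text \<open>The \<open>\<infinity>\<close>-direct sum of \<open>A\<close> and the complex numbers is realized on the Hilbert space direct
  sum of \<open>H\<close> and the complex numbers by block diagonal operators; the norm of a matrix of such
  operators is the maximum of the norms of its two diagonal blocks.\<close>

lift_definition op_dsum ::
    "('h::chilbert_space \<Rightarrow>\<^sub>L 'h) \<Rightarrow> complex \<Rightarrow> ('h \<times> complex) \<Rightarrow>\<^sub>L ('h \<times> complex)"
  is "\<lambda>T c (x, z). (T x, c * z)"
  unfolding case_prod_unfold
  by (intro bounded_linear_Pair bounded_linear_compose[OF _ bounded_linear_fst]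
      bounded_linear_compose[OF bounded_linear_mult_right bounded_linear_snd])

definition dsum_complex ::
    "('h::chilbert_space \<Rightarrow>\<^sub>L 'h) set \<Rightarrow> (('h \<times> complex) \<Rightarrow>\<^sub>L ('h \<times> complex)) set"
  where "dsum_complex A = {op_dsum a c | a c. a \<in> A}"

end

theory Submission
  imports Defs
begin

text \<open>Without a unit the extension has to be \<open>Q (a + c) = P a + c\<close>; if \<open>A\<close> has a unit \<open>e\<close>, the
  extension is \<open>Q (a, c) = (P a + c (e - P e), c)\<close>. Both are visibly unital, and idempotent when
  \<open>P\<close> is. The substance is that \<open>Q\<close> is real completely positive. Complete contractivity is then
  a consequence: \<open>\<parallel>X\<parallel> \<le> m\<close> can be read off from accretivity of a \<open>2 \<times> 2\<close> block matrix with \<open>m\<close>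
  on the diagonal and \<open>2 X\<close> in a corner (\<open>unital_real_positive_contractive\<close>).

  In the nonunital case let \<open>a + c\<close> be accretive, with \<open>a\<close> a matrix over \<open>A\<close> and \<open>c\<close> a scalar
  matrix. First, \<open>c\<close> itself is accretive, for otherwise \<open>A\<close> would contain a strictly accretive
  element and hence the identity (\<open>scalar_part_accretive\<close>). The skew part of \<open>c\<close> is invisible
  in the real part, so \<open>c\<close> may be replaced by a positive semidefinite matrix \<open>H\<close>. Next, in
  \<open>a + H \<otimes> 1\<close> the identity is replaced by a contraction \<open>f\<close> in \<open>A\<close> in such a way that
  \<open>a + H \<otimes> f\<close> is accretive up to \<open>\<eta>\<close> (\<open>accretive_compression\<close>). The map \<open>P\<close> is defined on this
  matrix; it preserves almost accretive matrices up to a factor 2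
  (\<open>positive_map_almost_accretive\<close>), so \<open>P a + H \<otimes> P f\<close> is almost accretive. Since
  \<open>\<parallel>P f\<parallel> \<le> 1\<close>, Schur's product theorem makes \<open>H \<otimes> (1 - P f)\<close> accretive. Adding up and letting
  \<open>\<eta>\<close> tend to 0 gives accretivity of \<open>P a + H \<otimes> 1\<close>.

  The element \<open>f\<close> is an average of members \<open>e\<^sub>k\<close> of an approximate identity. If \<open>e\<^sub>k\<close>
  were an orthogonal projection, one could compress by it and use \<open>e\<^sub>k* e\<^sub>k = e\<^sub>k\<close>. For a general
  contraction this fails, but the defects \<open>(1 - e\<^sub>k*) e\<^sub>k\<close> can be
  made almost orthogonal to each other, so that their average over many \<open>k\<close> is small
  (\<open>averaged_almost_units\<close>).

  In the unital case accretivity of \<open>(a, c)\<close> splits into that of \<open>a\<close> and that of \<open>c\<close>, and it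
  remains to see that \<open>c \<otimes> (e - P e)\<close> is accretive whenever \<open>c\<close> is
  (\<open>positive_map_complement\<close>).\<close>

section \<open>Inner products and adjoints\<close>

lemma cinner_diff_left: "cinner (x - y) z = cinner x z - cinner y z"
  using cinner_add_left[of "x - y" y z] by simp

lemma cinner_diff_right: "cinner x (y - z) = cinner x y - cinner x z"
  using cinner_add_right[of x "y - z" z] by simp

lemma cinner_zero_left [simp]: "cinner 0 x = 0"
  using cinner_diff_left[of x x x] by simp

lemma cinner_zero_right [simp]: "cinner x 0 = 0"
  using cinner_diff_right[of x x x] by simp

lemma cinner_minus_left: "cinner (- x) y = - cinner x y"
  using cinner_diff_left[of 0 x y] by simp

lemma cinner_sum_left: "cinner (\<Sum>i\<in>S. f i) x = (\<Sum>i\<in>S. cinner (f i) x)"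
  by (induction S rule: infinite_finite_induct) (auto simp: cinner_add_left)

lemma cinner_sum_right: "cinner x (\<Sum>i\<in>S. f i) = (\<Sum>i\<in>S. cinner x (f i))"
  by (induction S rule: infinite_finite_induct) (auto simp: cinner_add_right)

lemma Re_cinner_self: "Re (cinner x x) = (norm x)\<^sup>2"
  by (simp add: cinner_norm)

lemma norm_diff_sq: "(norm (x - y))\<^sup>2 = (norm x)\<^sup>2 - 2 * Re (cinner x y) + (norm y)\<^sup>2"
  using cinner_commute[of x y]
  by (simp add: cinner_diff_left cinner_diff_right flip: Re_cinner_self)

lemma cinner_le_norm: "cmod (cinner x y) \<le> norm x * norm y"
proof -
  have Re_le: "Re (cinner u w) \<le> norm u * norm w" for u w :: 'a
  proof -
    have "(norm (u + w))\<^sup>2 \<le> (norm u + norm w)\<^sup>2"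
      by (simp add: norm_triangle_ineq power_mono)
    then show ?thesis unfolding norm_add_sq power2_sum by simp
  qed
  \<comment> \<open>Rotating \<open>y\<close> by a phase makes the inner product equal to its modulus.\<close>
  define u where "u = cnj (sgn (cinner x y))"
  have "u * cinner x y = cmod (cinner x y)"
  proof (cases "cinner x y = 0")
    case False
    then show ?thesis
      using complex_norm_square[of "cinner x y"]
      by (simp add: u_def sgn_div_norm scaleR_conv_of_real power2_eq_square field_simps)
  qed auto
  then have "cmod (cinner x y) = Re (cinner x (u *\<^sub>C y))"
    by (simp add: cinner_scaleC_right)
  also have "\<dots> \<le> norm x * (cmod u * norm y)"
    using Re_le[of x "u *\<^sub>C y"] by (simp add: norm_scaleC)
  also have "\<dots> \<le> norm x * norm y"
    by (auto simp: u_def norm_sgn intro!: mult_left_mono)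
  finally show ?thesis .
qed

lemma norm_le_of_cinner:
  assumes "\<And>y. cmod (cinner u y) \<le> K * norm y" "0 \<le> K"
  shows "norm u \<le> K"
proof (cases "u = 0")
  case False
  have "(norm u)\<^sup>2 \<le> K * norm u"
    using assms(1)[of u] by (simp add: cinner_norm norm_power)
  with False show ?thesis
    by (simp add: power2_eq_square)
qed (use assms in auto)

lemma norm_blinfun_le: "norm T \<le> K \<Longrightarrow> norm (blinfun_apply T x) \<le> K * norm x"
  using norm_blinfun[of T x] by (meson mult_right_mono norm_ge_zero order_trans)

lemma norm_contraction_le: "norm T \<le> 1 \<Longrightarrow> norm (blinfun_apply T x) \<le> norm x"
  using norm_blinfun_le[of T 1 x] by simp

lemma norm_op_adjoint_apply:
  assumes "T \<in> bounded_operators" "norm T \<le> K"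
  shows "norm (op_adjoint T x) \<le> K * norm x"
proof (rule norm_le_of_cinner)
  have "0 \<le> K" using assms(2) norm_ge_zero order_trans by blast
  then show "0 \<le> K * norm x" by simp
  show "cmod (cinner (op_adjoint T x) y) \<le> K * norm x * norm y" for y
    using cinner_le_norm[of x "T y"] mult_left_mono[OF norm_blinfun_le[OF assms(2), of y] norm_ge_zero[of x]]
    by (simp add: op_adjoint_works[OF assms(1)] algebra_simps)
qed

text \<open>A vector that a contraction almost fixes is almost fixed by the adjoint, because
  \<open>\<parallel>S w - w\<parallel>\<^sup>2 \<le> 2 \<parallel>w\<parallel>\<^sup>2 - 2 Re \<langle>w, T w\<rangle>\<close>. This replaces selfadjointness of an approximate
  identity in all later estimates. The roles of \<open>T\<close> and its adjoint can be exchanged.\<close>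

lemma adjoint_almost_fixes:
  fixes S T :: "'h::chilbert_space \<Rightarrow> 'h"
  assumes adj: "cinner (S w) w = cinner w (T w)" and contr: "norm (S w) \<le> norm w"
  shows "(norm (S w - w))\<^sup>2 \<le> 2 * norm w * norm (T w - w)"
proof -
  have "Re (cinner w (T w)) = Re (cinner w (T w - w)) + (norm w)\<^sup>2"
    by (simp add: cinner_diff_right Re_cinner_self)
  moreover have "- Re (cinner w (T w - w)) \<le> norm w * norm (T w - w)"
    using cinner_le_norm[of w "T w - w"] abs_Re_le_cmod[of "cinner w (T w - w)"] by linarith
  moreover have "(norm (S w))\<^sup>2 \<le> (norm w)\<^sup>2"
    using contr by (simp add: power_mono)
  ultimately show ?thesis
    unfolding norm_diff_sq adj by linarith
qed

lemma scaleC_diff_right: "c *\<^sub>C (x - y) = c *\<^sub>C x - c *\<^sub>C (y::'a::chilbert_space)"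
  by (rule linear_diff[OF bounded_linear.linear[OF bounded_linear_scaleC]])

lemma op_scaleC_apply [simp]: "op_scaleC c T x = c *\<^sub>C T x"
  by (simp add: op_scaleC.rep_eq)

lemma op_scaleC_of_real: "op_scaleC (complex_of_real r) T = r *\<^sub>R T"
  by (rule blinfun_eqI) (simp add: scaleC_of_real blinfun.scaleR_left)

lemma op_scaleC_add_left: "op_scaleC (c + d) T = op_scaleC c T + op_scaleC d T"
  by (rule blinfun_eqI) (simp add: scaleC_add_left blinfun.add_left)

lemma op_scaleC_add_right: "op_scaleC c (S + T) = op_scaleC c S + op_scaleC c T"
  by (rule blinfun_eqI) (simp add: scaleC_add_right blinfun.add_left)

lemma op_scaleC_scaleC: "op_scaleC c (op_scaleC d T) = op_scaleC (c * d) T"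
  by (rule blinfun_eqI) (simp add: scaleC_scaleC)

lemma op_scaleC_zero_right: "op_scaleC c 0 = 0"
  by (rule blinfun_eqI) simp

lemma op_scaleC_zero [simp]: "op_scaleC 0 T = 0"
  using op_scaleC_of_real[of 0 T] by simp

lemma op_scaleC_one [simp]: "op_scaleC 1 T = T"
  using op_scaleC_of_real[of 1 T] by simp

section \<open>Averages of an approximate identity\<close>

lemma contractive_almost_unit:
  assumes "approximately_unital A" "finite S" "S \<subseteq> A" "\<theta> > 0"
  shows "\<exists>e\<in>A. norm e \<le> 1 \<and> (\<forall>s\<in>S. norm ((e o\<^sub>L s) - s) \<le> \<theta> \<and> norm ((s o\<^sub>L e) - s) \<le> \<theta>)"
proof -
  obtain F where F: "F \<noteq> bot" "eventually (\<lambda>e. e \<in> A \<and> norm e \<le> 1) F"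
    "\<And>a. a \<in> A \<Longrightarrow> ((\<lambda>e. e o\<^sub>L a) \<longlongrightarrow> a) F \<and> ((\<lambda>e. a o\<^sub>L e) \<longlongrightarrow> a) F"
    using assms(1) unfolding approximately_unital_def by blast
  have "eventually (\<lambda>e. norm ((e o\<^sub>L s) - s) \<le> \<theta> \<and> norm ((s o\<^sub>L e) - s) \<le> \<theta>) F" if "s \<in> S" for s
  proof -
    have "eventually (\<lambda>e. dist (e o\<^sub>L s) s < \<theta>) F" "eventually (\<lambda>e. dist (s o\<^sub>L e) s < \<theta>) F"
      using F(3)[of s] that assms(3,4) by (auto dest: tendstoD)
    then show ?thesis
      by eventually_elim (simp add: dist_norm)
  qed
  then have "eventually (\<lambda>e. \<forall>s\<in>S. norm ((e o\<^sub>L s) - s) \<le> \<theta> \<and> norm ((s o\<^sub>L e) - s) \<le> \<theta>) F"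
    using assms(2) by (simp add: eventually_ball_finite)
  with F(2) have "eventually (\<lambda>e. (e \<in> A \<and> norm e \<le> 1) \<and>
      (\<forall>s\<in>S. norm ((e o\<^sub>L s) - s) \<le> \<theta> \<and> norm ((s o\<^sub>L e) - s) \<le> \<theta>)) F"
    by (rule eventually_conj)
  then show ?thesis
    using eventually_happens[of _ F] F(1) by blast
qed

text \<open>Each member is an approximate unit for all earlier ones; this is what decouples their
  defects below.\<close>

lemma almost_unit_chain:
  fixes N :: nat
  assumes "approximately_unital A" "finite S" "S \<subseteq> A" "\<theta> > 0"
  shows "\<exists>E. \<forall>k<N. E k \<in> A \<and> norm (E k) \<le> 1 \<and>
    (\<forall>s\<in>S \<union> E ` {..<k}. norm ((E k o\<^sub>L s) - s) \<le> \<theta> \<and> norm ((s o\<^sub>L E k) - s) \<le> \<theta>)"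
proof (induction N)
  case (Suc N)
  then obtain E where E: "\<And>k. k < N \<Longrightarrow> E k \<in> A \<and> norm (E k) \<le> 1 \<and>
    (\<forall>s\<in>S \<union> E ` {..<k}. norm ((E k o\<^sub>L s) - s) \<le> \<theta> \<and> norm ((s o\<^sub>L E k) - s) \<le> \<theta>)"
    by blast
  obtain e where e: "e \<in> A" "norm e \<le> 1"
    "\<forall>s\<in>S \<union> E ` {..<N}. norm ((e o\<^sub>L s) - s) \<le> \<theta> \<and> norm ((s o\<^sub>L e) - s) \<le> \<theta>"
    using contractive_almost_unit[of A "S \<union> E ` {..<N}" \<theta>] assms E by auto
  have "(E(N := e)) ` {..<k} = E ` {..<k}" if "k \<le> N" for k
    using that by auto
  then have "\<forall>k<Suc N. (E(N := e)) k \<in> A \<and> norm ((E(N := e)) k) \<le> 1 \<and>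
    (\<forall>s\<in>S \<union> (E(N := e)) ` {..<k}.
      norm (((E(N := e)) k o\<^sub>L s) - s) \<le> \<theta> \<and> norm ((s o\<^sub>L (E(N := e)) k) - s) \<le> \<theta>)"
    using E e by (simp add: less_Suc_eq_le nat_less_le)
  then show ?case by blast
qed auto

lemma almost_unit_sandwich:
  assumes e: "e \<in> bounded_operators" "norm e \<le> 1"
    and \<theta>: "norm ((e o\<^sub>L s) - s) \<le> \<theta>" "norm ((s o\<^sub>L e) - s) \<le> \<theta>" and M: "norm s \<le> M"
  shows "cmod (cinner (e x) (s (e y)) - cinner x (s y)) \<le> (\<theta> + sqrt (2 * M * \<theta>)) * norm x * norm y"
proof -
  define w where "w = s y"
  have \<theta>0: "0 \<le> \<theta>" "0 \<le> M"
    using \<theta>(1) M norm_ge_zero order_trans by blast+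
  have "norm (s (e y) - w) \<le> \<theta> * norm y"
    using norm_blinfun_le[OF \<theta>(2), of y] by (simp add: w_def blinfun.diff_left)
  then have 1: "cmod (cinner (e x) (s (e y) - w)) \<le> norm x * (\<theta> * norm y)"
    using norm_contraction_le[OF e(2), of x] cinner_le_norm[of "e x" "s (e y) - w"]
      mult_mono[of "norm (e x)" "norm x" "norm (s (e y) - w)" "\<theta> * norm y"]
    by (meson norm_ge_zero order_trans)
  have "norm (e w - w) \<le> \<theta> * norm y"
    using norm_blinfun_le[OF \<theta>(1), of y] by (simp add: w_def blinfun.diff_left)
  then have "(norm (op_adjoint e w - w))\<^sup>2 \<le> 2 * (M * norm y) * (\<theta> * norm y)"
    using adjoint_almost_fixes[of "blinfun_apply (op_adjoint e)" w "blinfun_apply e"]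
      norm_op_adjoint_apply[OF e, of w] op_adjoint_works[OF e(1), of w w]
      mult_mono[of "2 * norm w" "2 * (M * norm y)" "norm (e w - w)" "\<theta> * norm y"]
      norm_blinfun_le[OF M, of y] \<theta>0
    by (simp add: w_def)
  also have "\<dots> = (sqrt (2 * M * \<theta>) * norm y)\<^sup>2"
    using \<theta>0 by (simp add: power_mult_distrib) (simp add: power2_eq_square)
  finally have "norm (op_adjoint e w - w) \<le> sqrt (2 * M * \<theta>) * norm y"
    by (rule power2_le_imp_le) (use \<theta>0 in simp)
  then have "cmod (cinner x (op_adjoint e w - w)) \<le> norm x * (sqrt (2 * M * \<theta>) * norm y)"
    using cinner_le_norm[of x "op_adjoint e w - w"] by (meson mult_left_mono norm_ge_zero order_trans)
  moreover have "cinner x (op_adjoint e w - w) = cinner (e x - x) w"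
    using op_adjoint_works[OF e(1), of w x] cinner_commute[of x "op_adjoint e w"] cinner_commute[of w "e x"]
    by (simp add: cinner_diff_left cinner_diff_right)
  ultimately have 2: "cmod (cinner (e x - x) w) \<le> norm x * (sqrt (2 * M * \<theta>) * norm y)"
    by simp
  have "cinner (e x) (s (e y)) - cinner x (s y) =
      cinner (e x) (s (e y) - w) + cinner (e x - x) w"
    by (simp add: w_def cinner_diff_left cinner_diff_right)
  then have "cmod (cinner (e x) (s (e y)) - cinner x (s y)) \<le>
      norm x * (\<theta> * norm y) + norm x * (sqrt (2 * M * \<theta>) * norm y)"
    using 1 2 norm_triangle_ineq[of "cinner (e x) (s (e y) - w)" "cinner (e x - x) w"] by simp
  then show ?thesis by (simp add: algebra_simps)
qed

text \<open>The operators \<open>u\<^sub>k = (1 - e\<^sub>k*) e\<^sub>k\<close> measure how far the \<open>e\<^sub>k\<close> are from being projections.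
  Each of them may have norm of order 1, but if \<open>e\<^sub>k\<close> is almost a unit for \<open>e\<^sub>j\<close> then it is
  almost a unit for \<open>e\<^sub>j*\<close> too, hence \<open>(1 - e\<^sub>k) u\<^sub>j\<close> is small, and \<open>u\<^sub>j\<close>, \<open>u\<^sub>k\<close> have
  almost orthogonal ranges.\<close>

lemma projection_defects_almost_orthogonal:
  fixes d e :: "'h::chilbert_space \<Rightarrow>\<^sub>L 'h"
  assumes d: "d \<in> bounded_operators" "norm d \<le> 1"
    and e: "e \<in> bounded_operators" "norm e \<le> 1"
    and \<theta>: "norm ((e o\<^sub>L d) - d) \<le> \<theta>" "norm ((d o\<^sub>L e) - d) \<le> \<theta>"
  shows "cmod (cinner (d y - op_adjoint d (d y)) (e y - op_adjoint e (e y))) \<le>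
    (\<theta> + sqrt (2 * \<theta>)) * (norm y)\<^sup>2"
proof -
  define w where "w = op_adjoint d (d y)"
  define u where "u = d y - w"
  have \<theta>0: "0 \<le> \<theta>"
    using \<theta>(1) norm_ge_zero order_trans by blast
  have dy: "norm (d y) \<le> norm y" and ey: "norm (e y) \<le> norm y"
    using norm_contraction_le d(2) e(2) by blast+
  have w: "norm w \<le> norm y"
    using norm_op_adjoint_apply[OF d, of "d y"] dy unfolding w_def by linarith
  have "norm (op_adjoint e w - w) \<le> \<theta> * norm y"
  proof (rule norm_le_of_cinner)
    fix z
    have "cinner (op_adjoint e w - w) z = cinner (d y) (d (e z) - d z)"
      by (simp add: w_def cinner_diff_left cinner_diff_right op_adjoint_works d(1) e(1))
    moreover have "norm (d (e z) - d z) \<le> \<theta> * norm z"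
      using norm_blinfun_le[OF \<theta>(2), of z] by (simp add: blinfun.diff_left)
    ultimately have "cmod (cinner (op_adjoint e w - w) z) \<le> norm y * (\<theta> * norm z)"
      using cinner_le_norm[of "d y" "d (e z) - d z"] dy
        mult_mono[of "norm (d y)" "norm y" "norm (d (e z) - d z)" "\<theta> * norm z"]
      by simp
    then show "cmod (cinner (op_adjoint e w - w) z) \<le> \<theta> * norm y * norm z"
      by (simp add: algebra_simps)
  qed (use \<theta>0 in simp)
  moreover have "cinner (e w) w = cinner w (op_adjoint e w)"
    by (metis cinner_commute op_adjoint_works[OF e(1)])
  ultimately have "(norm (e w - w))\<^sup>2 \<le> 2 * norm y * (\<theta> * norm y)"
    using adjoint_almost_fixes[of "blinfun_apply e" w "blinfun_apply (op_adjoint e)"]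
      norm_contraction_le[OF e(2), of w] w \<theta>0
      mult_mono[of "2 * norm w" "2 * norm y" "norm (op_adjoint e w - w)" "\<theta> * norm y"]
    by simp
  also have "\<dots> = (sqrt (2 * \<theta>) * norm y)\<^sup>2"
    using \<theta>0 by (simp add: power_mult_distrib) (simp add: power2_eq_square)
  finally have "norm (e w - w) \<le> sqrt (2 * \<theta>) * norm y"
    by (rule power2_le_imp_le) (use \<theta>0 in simp)
  moreover have "norm (d y - e (d y)) \<le> \<theta> * norm y"
    using norm_blinfun_le[OF \<theta>(1), of y] by (simp add: blinfun.diff_left norm_minus_commute)
  moreover have eq: "u - e u = (d y - e (d y)) + (e w - w)"
    by (simp add: u_def blinfun.diff_right)
  ultimately have "norm (u - e u) \<le> \<theta> * norm y + sqrt (2 * \<theta>) * norm y"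
    unfolding eq using norm_triangle_ineq[of "d y - e (d y)" "e w - w"] by linarith
  then have "norm (u - e u) \<le> (\<theta> + sqrt (2 * \<theta>)) * norm y"
    by (simp add: distrib_right)
  then have "norm (u - e u) * norm (e y) \<le> (\<theta> + sqrt (2 * \<theta>)) * norm y * norm y"
    using ey \<theta>0 by (intro mult_mono) auto
  moreover have "cinner u (e y - op_adjoint e (e y)) = cinner (u - e u) (e y)"
    using op_adjoint_works[OF e(1), of "e y" u] cinner_commute[of u "op_adjoint e (e y)"]
      cinner_commute[of "e y" "e u"]
    by (simp add: cinner_diff_left cinner_diff_right)
  ultimately show ?thesis
    using cinner_le_norm[of "u - e u" "e y"]
    by (simp add: u_def w_def power2_eq_square algebra_simps)
qed

text \<open>Cauchy-Schwarz for \<open>\<Sum>k<N. u\<^sub>k y\<close>: the \<open>N\<close> diagonal terms contribute \<open>O(N)\<close> and the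
  almost vanishing off-diagonal ones at most \<open>N\<^sup>2 \<eta>\<^sup>2 / 2\<close> to the squared norm, against the
  required bound \<open>N\<^sup>2 \<eta>\<^sup>2\<close>. Hence on average \<open>E k* E k\<close> can be replaced by \<open>E k\<close>, although no
  single \<open>E k\<close> need have this property.\<close>

lemma averaged_almost_units:
  assumes "A \<subseteq> bounded_operators" "approximately_unital A" "finite S" "S \<subseteq> A" "\<eta> > 0"
  shows "\<exists>N E. 0 < (N::nat) \<and> (\<forall>k<N. E k \<in> A \<and> norm (E k) \<le> 1) \<and>
    (\<forall>k<N. \<forall>s\<in>S. \<forall>x y. cmod (cinner (E k x) (s (E k y)) - cinner x (s y)) \<le> \<eta> * norm x * norm y) \<and>
    (\<forall>x y. cmod (\<Sum>k<N. cinner x (E k y) - cinner (E k x) (E k y)) \<le> real N * \<eta> * norm x * norm y)"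
proof -
  define M where "M = (\<Sum>s\<in>S. norm s)"
  have M: "norm s \<le> M" if "s \<in> S" for s
    unfolding M_def using that assms(3) by (intro member_le_sum) auto
  have lim: "((\<lambda>\<theta>. \<theta> + sqrt (2 * m * \<theta>)) \<longlongrightarrow> 0) (at_right 0)" for m :: real
    by (auto intro!: tendsto_eq_intros)
  have "eventually (\<lambda>\<theta>. \<theta> + sqrt (2 * M * \<theta>) < \<eta>) (at_right 0)"
    "eventually (\<lambda>\<theta>. \<theta> + sqrt (2 * 1 * \<theta>) < \<eta>\<^sup>2 / 2) (at_right 0)"
    using order_tendstoD(2)[OF lim] assms(5) by (metis, metis half_gt_zero zero_less_power)
  moreover have "eventually (\<lambda>\<theta>::real. 0 < \<theta>) (at_right 0)"
    by (simp add: eventually_at_right_less)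
  ultimately have "eventually (\<lambda>\<theta>. \<theta> + sqrt (2 * M * \<theta>) < \<eta> \<and> \<theta> + sqrt (2 * 1 * \<theta>) < \<eta>\<^sup>2 / 2
      \<and> 0 < \<theta>) (at_right 0)"
    by (intro eventually_conj)
  then obtain \<theta> where \<theta>: "\<theta> + sqrt (2 * M * \<theta>) < \<eta>" "\<theta> + sqrt (2 * \<theta>) < \<eta>\<^sup>2 / 2" "0 < \<theta>"
    using eventually_happens[of _ "at_right (0::real)"] by auto
  define N where "N = nat \<lceil>8 / \<eta>\<^sup>2\<rceil> + 1"
  have "8 / \<eta>\<^sup>2 \<le> N"
    unfolding N_def by linarith
  then have N: "0 < N" "8 \<le> real N * \<eta>\<^sup>2"
    using assms(5) by (auto simp: N_def field_simps)
  obtain E where "\<forall>k<N. E k \<in> A \<and> norm (E k) \<le> 1 \<and>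
    (\<forall>s\<in>S \<union> E ` {..<k}. norm ((E k o\<^sub>L s) - s) \<le> \<theta> \<and> norm ((s o\<^sub>L E k) - s) \<le> \<theta>)"
    using almost_unit_chain[OF assms(2-4) \<theta>(3)] by blast
  then have E: "E k \<in> A" "norm (E k) \<le> 1" "E k \<in> bounded_operators"
    and ES: "\<And>s. s \<in> S \<Longrightarrow> norm ((E k o\<^sub>L s) - s) \<le> \<theta> \<and> norm ((s o\<^sub>L E k) - s) \<le> \<theta>"
    and EE: "\<And>j. j < k \<Longrightarrow> norm ((E k o\<^sub>L E j) - E j) \<le> \<theta> \<and> norm ((E j o\<^sub>L E k) - E j) \<le> \<theta>"
    if "k < N" for k
    using that assms(1) by auto
  have "cmod (cinner (E k x) (s (E k y)) - cinner x (s y)) \<le> \<eta> * norm x * norm y"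
    if "k < N" "s \<in> S" for k s x y
  proof -
    have "cmod (cinner (E k x) (s (E k y)) - cinner x (s y)) \<le> (\<theta> + sqrt (2 * M * \<theta>)) * norm x * norm y"
      using almost_unit_sandwich[of "E k" s \<theta> M x y] E ES M that by blast
    also have "\<dots> \<le> \<eta> * norm x * norm y"
      using \<theta>(1) by (intro mult_right_mono) auto
    finally show ?thesis .
  qed
  moreover have "cmod (\<Sum>k<N. cinner x (E k y) - cinner (E k x) (E k y)) \<le> real N * \<eta> * norm x * norm y"
    for x y
  proof -
    define u where "u k = E k y - op_adjoint (E k) (E k y)" for k
    have u: "norm (u k) \<le> 2 * norm y" if "k < N" for k
      using norm_contraction_le[OF E(2)[OF that], of y] norm_op_adjoint_apply[OF E(3,2), OF that that, of "E k y"]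
        norm_triangle_ineq4[of "E k y" "op_adjoint (E k) (E k y)"]
      unfolding u_def by linarith
    have lt: "cmod (cinner (u j) (u k)) \<le> \<eta>\<^sup>2 / 2 * (norm y)\<^sup>2" if "j < k" "k < N" for j k
    proof -
      have "cmod (cinner (u j) (u k)) \<le> (\<theta> + sqrt (2 * \<theta>)) * (norm y)\<^sup>2"
        using projection_defects_almost_orthogonal[of "E j" "E k" \<theta> y] E EE that unfolding u_def by auto
      also have "\<dots> \<le> \<eta>\<^sup>2 / 2 * (norm y)\<^sup>2"
        using \<theta>(2) by (intro mult_right_mono) auto
      finally show ?thesis .
    qed
    have "Re (cinner (u j) (u k)) \<le> (if j = k then 4 * (norm y)\<^sup>2 else 0) + \<eta>\<^sup>2 / 2 * (norm y)\<^sup>2"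
      if "j < N" "k < N" for j k
    proof (cases j k rule: linorder_cases)
      case equal
      have "(norm (u k))\<^sup>2 \<le> (2 * norm y)\<^sup>2"
        using u[OF that(2)] by (rule power_mono) simp
      then show ?thesis
        using equal by (simp add: Re_cinner_self power_mult_distrib add_increasing2)
    next
      case greater
      have "cmod (cinner (u j) (u k)) = cmod (cinner (u k) (u j))"
        by (subst cinner_commute) simp
      then show ?thesis
        using greater lt[of k j] complex_Re_le_cmod[of "cinner (u j) (u k)"] that by simp
    qed (use lt[of j k] complex_Re_le_cmod[of "cinner (u j) (u k)"] that in simp)
    then have "(norm (\<Sum>k<N. u k))\<^sup>2 \<le>
        (\<Sum>k<N. \<Sum>j<N. (if j = k then 4 * (norm y)\<^sup>2 else 0) + \<eta>\<^sup>2 / 2 * (norm y)\<^sup>2)"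
      unfolding Re_cinner_self[symmetric] cinner_sum_left cinner_sum_right Re_sum
      by (intro sum_mono) auto
    also have "\<dots> = real N * 4 * (norm y)\<^sup>2 + (real N)\<^sup>2 * (\<eta>\<^sup>2 / 2) * (norm y)\<^sup>2"
      by (simp add: sum.distrib power2_eq_square distrib_left)
    also have "\<dots> \<le> real N * (real N * \<eta>\<^sup>2 / 2) * (norm y)\<^sup>2 + (real N)\<^sup>2 * (\<eta>\<^sup>2 / 2) * (norm y)\<^sup>2"
      using N by (intro add_right_mono mult_right_mono mult_left_mono) auto
    also have "\<dots> = (real N * \<eta> * norm y)\<^sup>2"
      by (simp add: power_mult_distrib) (simp add: power2_eq_square)
    finally have "norm (\<Sum>k<N. u k) \<le> real N * \<eta> * norm y"
      by (rule power2_le_imp_le) (use assms(5) in simp)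
    then have "norm x * norm (\<Sum>k<N. u k) \<le> norm x * (real N * \<eta> * norm y)"
      by (rule mult_left_mono) simp
    moreover have "(\<Sum>k<N. cinner x (E k y) - cinner (E k x) (E k y)) = cinner x (\<Sum>k<N. u k)"
      unfolding cinner_sum_right
    proof (rule sum.cong)
      fix k assume "k \<in> {..<N}"
      then show "cinner x (E k y) - cinner (E k x) (E k y) = cinner x (u k)"
        using op_adjoint_works[OF E(3), of k "E k y" x] cinner_commute[of x "op_adjoint (E k) (E k y)"]
          cinner_commute[of "E k y" "E k x"]
        by (simp add: u_def cinner_diff_right)
    qed auto
    ultimately show ?thesis
      using cinner_le_norm[of x "\<Sum>k<N. u k"] by (simp add: algebra_simps)
  qed
  ultimately show ?thesis
    using N E by (intro exI[of _ N] exI[of _ E]) simp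
qed

section \<open>Accretive matrices\<close>

text \<open>The matrices \<open>X\<close> with \<open>X + X* \<ge> 0\<close> are those with nonnegative \<open>re_form\<close>, which avoids
  adjoints and makes positivity a statement about real numbers.\<close>

definition re_form :: "nat \<Rightarrow> (nat \<Rightarrow> nat \<Rightarrow> 'h::chilbert_space \<Rightarrow>\<^sub>L 'h) \<Rightarrow> (nat \<Rightarrow> 'h) \<Rightarrow> real"
  where "re_form n X v = (\<Sum>i<n. \<Sum>j<n. Re (cinner (v i) (X i j (v j))))"

lemma vec_norm_nonneg [simp]: "0 \<le> vec_norm n v"
  by (simp add: vec_norm_def sum_nonneg)

lemma vec_norm_sq: "(vec_norm n v)\<^sup>2 = (\<Sum>i<n. (norm (v i))\<^sup>2)"
  by (simp add: vec_norm_def sum_nonneg)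

lemma norm_le_vec_norm: "i < n \<Longrightarrow> norm (v i) \<le> vec_norm n v"
  by (rule power2_le_imp_le) (auto simp: vec_norm_sq intro!: member_le_sum[of i "{..<n}" "\<lambda>i. (norm (v i))\<^sup>2"])

lemma re_form_cong:
  "(\<And>i j. i < n \<Longrightarrow> j < n \<Longrightarrow> X i j = Y i j) \<Longrightarrow> re_form n X v = re_form n Y v"
  unfolding re_form_def by (intro sum.cong) auto

lemma re_form_add: "re_form n (\<lambda>i j. X i j + Y i j) v = re_form n X v + re_form n Y v"
  by (simp add: re_form_def blinfun.add_left cinner_add_right sum.distrib)

lemma real_positive_iff:
  assumes "A \<subseteq> bounded_operators"
  shows "X \<in> real_positive n A \<longleftrightarrow> X \<in> matrices n A \<and> (\<forall>v. 0 \<le> re_form n X v)"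
proof -
  have "vec_cinner n v (mat_apply n (mat_plus X (mat_adjoint X)) v) = complex_of_real (2 * re_form n X v)"
    if "X \<in> matrices n A" for v
  proof -
    have X: "X i j \<in> bounded_operators" if "i < n" "j < n" for i j
      using that \<open>X \<in> matrices n A\<close> assms unfolding matrices_def by blast
    have "vec_cinner n v (mat_apply n (mat_plus X (mat_adjoint X)) v) =
      (\<Sum>i<n. \<Sum>j<n. cinner (v i) (X i j (v j))) + (\<Sum>i<n. \<Sum>j<n. cinner (v i) (op_adjoint (X j i) (v j)))"
      by (simp add: vec_cinner_def mat_apply_def mat_plus_def mat_adjoint_def blinfun.add_left
          cinner_sum_right cinner_add_right sum.distrib)
    also have "(\<Sum>i<n. \<Sum>j<n. cinner (v i) (op_adjoint (X j i) (v j))) =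
        (\<Sum>i<n. \<Sum>j<n. cnj (cinner (v j) (X j i (v i))))"
    proof (intro sum.cong refl)
      fix i j assume "i \<in> {..<n}" "j \<in> {..<n}"
      then show "cinner (v i) (op_adjoint (X j i) (v j)) = cnj (cinner (v j) (X j i (v i)))"
        using op_adjoint_works[OF X, of j i "v j" "v i"] cinner_commute[of "v i" "op_adjoint (X j i) (v j)"]
        by simp
    qed
    also have "\<dots> = cnj (\<Sum>i<n. \<Sum>j<n. cinner (v i) (X i j (v j)))"
      by (subst sum.swap) simp
    also have "(\<Sum>i<n. \<Sum>j<n. cinner (v i) (X i j (v j))) + \<dots> = complex_of_real (2 * re_form n X v)"
      by (simp only: complex_add_cnj) (simp add: re_form_def)
    finally show ?thesis .
  qed
  then show ?thesis
    unfolding real_positive_def mat_positive_def by (auto simp del: of_real_mult simp: nonneg_Reals_of_real_iff)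
qed

lemma operator_algebraD:
  assumes "operator_algebra A"
  shows "A \<subseteq> bounded_operators" "closed A" "0 \<in> A"
    "\<And>a b. a \<in> A \<Longrightarrow> b \<in> A \<Longrightarrow> a + b \<in> A"
    "\<And>c a. a \<in> A \<Longrightarrow> op_scaleC c a \<in> A"
    "\<And>r a. a \<in> A \<Longrightarrow> r *\<^sub>R a \<in> A"
    "\<And>a b. a \<in> A \<Longrightarrow> b \<in> A \<Longrightarrow> a - b \<in> A"
    "\<And>a b. a \<in> A \<Longrightarrow> b \<in> A \<Longrightarrow> a o\<^sub>L b \<in> A"
    "\<And>f I. (\<And>i. i \<in> I \<Longrightarrow> f i \<in> A) \<Longrightarrow> sum f I \<in> A"
proof -
  show scaleR: "r *\<^sub>R a \<in> A" if "a \<in> A" for r a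
    using assms that op_scaleC_of_real[of r a] unfolding operator_algebra_def by metis
  show add: "a + b \<in> A" if "a \<in> A" "b \<in> A" for a b
    using assms that unfolding operator_algebra_def by blast
  show "a - b \<in> A" if "a \<in> A" "b \<in> A" for a b
    using add[OF that(1) scaleR[OF that(2), of "-1"]] by simp
  show zero: "0 \<in> A"
    using assms unfolding operator_algebra_def by blast
  show "sum f I \<in> A" if "\<And>i. i \<in> I \<Longrightarrow> f i \<in> A" for f and I :: "'z set"
    using that by (induction I rule: infinite_finite_induct) (auto simp: zero add)
qed (use assms in \<open>auto simp: operator_algebra_def\<close>)

lemma matrix_entries:
  assumes "a \<in> matrices n A"
  obtains S where "finite S" "S \<subseteq> A" "a \<in> matrices n S"
proof (rule that[of "(\<lambda>(i, j). a i j) ` ({..<n} \<times> {..<n})"])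
  show "(\<lambda>(i, j). a i j) ` ({..<n} \<times> {..<n}) \<subseteq> A"
    using assms by (auto simp: matrices_def)
qed (auto simp: matrices_def)

text \<open>Accretivity is tested on the compressed vectors \<open>E k v\<close> and averaged over \<open>k\<close>. Sandwiching
  between \<open>E k*\<close> and \<open>E k\<close> almost fixes the entries of \<open>a\<close> and turns the identity into
  \<open>E k* E k\<close>, whose average is almost the average \<open>f\<close> of the \<open>E k\<close>.\<close>

lemma accretive_compression:
  assumes A: "operator_algebra A" "approximately_unital A"
    and a: "a \<in> matrices n A" and \<eta>: "0 < \<eta>"
    and pos: "\<And>v. 0 \<le> re_form n (\<lambda>i j. a i j + op_scaleC (c i j) id_blinfun) v"
  shows "\<exists>f\<in>A. norm f \<le> 1 \<and>
    (\<forall>v. - \<eta> * (vec_norm n v)\<^sup>2 \<le> re_form n (\<lambda>i j. a i j + op_scaleC (c i j) f) v)"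
proof -
  obtain S where S: "finite S" "S \<subseteq> A" and aS: "a \<in> matrices n S"
    using matrix_entries[OF a] .
  define K where "K = (\<Sum>i<n. \<Sum>j<n. cmod (c i j))"
  have c: "cmod (c i j) \<le> K" if "i < n" "j < n" for i j
  proof -
    have "cmod (c i j) \<le> (\<Sum>j<n. cmod (c i j))"
      using that by (intro member_le_sum) auto
    also have "\<dots> \<le> K"
      unfolding K_def using that by (intro member_le_sum sum_nonneg) auto
    finally show ?thesis .
  qed
  have K: "0 \<le> K" unfolding K_def by (intro sum_nonneg) auto
  \<comment> \<open>Each of the \<open>n\<^sup>2\<close> entries costs one error for \<open>a i j\<close> and one, weighted by \<open>K\<close>, for \<open>c i j\<close>.\<close>
  define L where "L = (1 + K) * (real n)\<^sup>2 + 1"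
  have L: "1 \<le> L" using K by (simp add: L_def)
  then have "0 < \<eta> / L" using \<eta> by simp
  obtain N E where N: "0 < (N::nat)" and E_all: "\<forall>k<N. E k \<in> A \<and> norm (E k) \<le> 1"
    and sandwich_all: "\<forall>k<N. \<forall>s\<in>S. \<forall>x y.
      cmod (cinner (E k x) (s (E k y)) - cinner x (s y)) \<le> \<eta> / L * norm x * norm y"
    and average_all: "\<forall>x y. cmod (\<Sum>k<N. cinner x (E k y) - cinner (E k x) (E k y)) \<le>
      real N * (\<eta> / L) * norm x * norm y"
    using averaged_almost_units[OF operator_algebraD(1)[OF A(1)] A(2) S \<open>0 < \<eta> / L\<close>]
    by (elim exE conjE) (rule that)
  note E = E_all[rule_format, THEN conjunct1] E_all[rule_format, THEN conjunct2]
  note sandwich = sandwich_all[rule_format] and average = average_all[rule_format]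
  define f where "f = (1 / real N) *\<^sub>R (\<Sum>k<N. E k)"
  have "f \<in> A"
    unfolding f_def using E(1) by (intro operator_algebraD[OF A(1)]) auto
  moreover have "norm f \<le> 1"
    using norm_sum[of E "{..<N}"] sum_mono[of "{..<N}" "\<lambda>k. norm (E k)" "\<lambda>_. 1"] E(2) N
    by (simp add: f_def field_simps)
  moreover have "- \<eta> * (vec_norm n v)\<^sup>2 \<le> re_form n (\<lambda>i j. a i j + op_scaleC (c i j) f) v" for v
  proof -
    define V where "V = vec_norm n v"
    define G where "G i j = (\<Sum>k<N. cinner (v i) (a i j (v j)) + c i j * cinner (v i) (E k (v j)))
      - (\<Sum>k<N. cinner (E k (v i)) (a i j (E k (v j))) + c i j * cinner (E k (v i)) (E k (v j)))" for i j
    have G: "cmod (G i j) \<le> real N * (\<eta> / L) * (1 + K) * V\<^sup>2" if ij: "i < n" "j < n" for i j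
    proof -
      have eq: "G i j = (\<Sum>k<N. cinner (v i) (a i j (v j)) - cinner (E k (v i)) (a i j (E k (v j))))
          + c i j * (\<Sum>k<N. cinner (v i) (E k (v j)) - cinner (E k (v i)) (E k (v j)))"
        unfolding G_def by (simp add: sum.distrib sum_subtractf sum_distrib_left algebra_simps)
      have n1: "cmod (\<Sum>k<N. cinner (v i) (a i j (v j)) - cinner (E k (v i)) (a i j (E k (v j)))) \<le>
          real N * (\<eta> / L * norm (v i) * norm (v j))"
        using aS ij sandwich[of _ "a i j" "v i" "v j"]
        by (intro order_trans[OF norm_sum] order_trans[OF sum_bounded_above])
          (auto simp: matrices_def norm_minus_commute)
      have n2: "cmod (c i j * (\<Sum>k<N. cinner (v i) (E k (v j)) - cinner (E k (v i)) (E k (v j)))) \<le>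
          K * (real N * (\<eta> / L) * norm (v i) * norm (v j))"
        unfolding norm_mult using c ij average K by (intro mult_mono) auto
      have "cmod (G i j) \<le> real N * (\<eta> / L * norm (v i) * norm (v j)) +
          K * (real N * (\<eta> / L) * norm (v i) * norm (v j))"
        unfolding eq by (rule norm_triangle_le[OF add_mono[OF n1 n2]])
      also have "\<dots> = real N * (\<eta> / L) * (1 + K) * (norm (v i) * norm (v j))"
        by (simp add: algebra_simps add_divide_distrib)
      also have "\<dots> \<le> real N * (\<eta> / L) * (1 + K) * (V * V)"
        using ij K \<eta> L by (intro mult_left_mono mult_mono) (auto simp: V_def norm_le_vec_norm)
      finally show ?thesis by (simp add: power2_eq_square)
    qed
    have "0 \<le> (\<Sum>k<N. re_form n (\<lambda>i j. a i j + op_scaleC (c i j) id_blinfun) (\<lambda>i. E k (v i)))"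
      using pos by (intro sum_nonneg) auto
    also have "\<dots> = (\<Sum>i<n. \<Sum>j<n. Re (\<Sum>k<N. cinner (E k (v i)) (a i j (E k (v j))) +
        c i j * cinner (E k (v i)) (E k (v j))))"
      unfolding re_form_def Re_sum
      by (subst sum.swap, rule sum.cong[OF refl], subst sum.swap)
        (simp add: blinfun.add_left cinner_add_right cinner_scaleC_right)
    also have "\<dots> = (\<Sum>i<n. \<Sum>j<n. Re (\<Sum>k<N. cinner (v i) (a i j (v j)) +
        c i j * cinner (v i) (E k (v j))) - Re (G i j))"
      by (simp add: G_def)
    also have "\<dots> \<le> (\<Sum>i<n. \<Sum>j<n. Re (\<Sum>k<N. cinner (v i) (a i j (v j)) +
        c i j * cinner (v i) (E k (v j))) + real N * (\<eta> / L) * (1 + K) * V\<^sup>2)"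
    proof (intro sum_mono)
      fix i j assume "i \<in> {..<n}" "j \<in> {..<n}"
      then show "Re (\<Sum>k<N. cinner (v i) (a i j (v j)) + c i j * cinner (v i) (E k (v j))) - Re (G i j) \<le>
          Re (\<Sum>k<N. cinner (v i) (a i j (v j)) + c i j * cinner (v i) (E k (v j)))
            + real N * (\<eta> / L) * (1 + K) * V\<^sup>2"
        using G[of i j] abs_Re_le_cmod[of "G i j"] by simp
    qed
    also have "\<dots> = real N * re_form n (\<lambda>i j. a i j + op_scaleC (c i j) f) v
        + (real n)\<^sup>2 * (real N * (\<eta> / L) * (1 + K) * V\<^sup>2)"
    proof -
      have f_form: "of_nat N * cinner x (f y) = (\<Sum>k<N. cinner x (E k y))" for x y
        using N by (simp add: f_def blinfun.scaleR_left blinfun.sum_left cinner_scaleR_right cinner_sum_right)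
      have "(\<Sum>k<N. cinner (v i) (a i j (v j)) + c i j * cinner (v i) (E k (v j))) =
          of_nat N * cinner (v i) ((a i j + op_scaleC (c i j) f) (v j))" for i j
        unfolding sum.distrib sum_distrib_left[symmetric] f_form[symmetric]
        by (simp add: blinfun.add_left cinner_add_right cinner_scaleC_right distrib_left)
      then have "Re (\<Sum>k<N. cinner (v i) (a i j (v j)) + c i j * cinner (v i) (E k (v j))) =
          real N * Re (cinner (v i) ((a i j + op_scaleC (c i j) f) (v j)))" for i j
        by (simp del: Re_sum)
      then show ?thesis
        by (simp add: re_form_def sum.distrib sum_distrib_left power2_eq_square del: Re_sum)
    qed
    also have "(real n)\<^sup>2 * (real N * (\<eta> / L) * (1 + K) * V\<^sup>2) = real N * (((1 + K) * (real n)\<^sup>2 / L) * (\<eta> * V\<^sup>2))"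
      by simp
    also have "\<dots> \<le> real N * (1 * (\<eta> * V\<^sup>2))"
      using L \<eta> by (intro mult_left_mono mult_right_mono) (auto simp: L_def)
    finally have "0 \<le> real N * (re_form n (\<lambda>i j. a i j + op_scaleC (c i j) f) v + \<eta> * V\<^sup>2)"
      by (simp add: algebra_simps)
    then show ?thesis
      using N by (simp add: V_def zero_le_mult_iff)
  qed
  ultimately show ?thesis by blast
qed

section \<open>Positive semidefinite scalar matrices\<close>

definition psd :: "nat \<Rightarrow> (nat \<Rightarrow> nat \<Rightarrow> complex) \<Rightarrow> bool"
  where "psd n H \<longleftrightarrow> (\<forall>i<n. \<forall>j<n. H j i = cnj (H i j)) \<and>
    (\<forall>\<mu>. 0 \<le> Re (\<Sum>i<n. \<Sum>j<n. cnj (\<mu> i) * H i j * \<mu> j))"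

lemma psdD:
  assumes "psd n H"
  shows "i < n \<Longrightarrow> j < n \<Longrightarrow> H j i = cnj (H i j)"
    "0 \<le> Re (\<Sum>i<n. \<Sum>j<n. cnj (\<mu> i) * H i j * \<mu> j)"
  using assms unfolding psd_def by blast+

lemma sum2_two_points:
  fixes f :: "nat \<Rightarrow> nat \<Rightarrow> 'b::comm_monoid_add"
  assumes "i < n" "k < n" "i \<noteq> k"
    and "\<And>p q. p \<notin> {i, k} \<or> q \<notin> {i, k} \<Longrightarrow> f p q = 0"
  shows "(\<Sum>p<n. \<Sum>q<n. f p q) = f i i + f i k + (f k i + f k k)"
proof -
  have "(\<Sum>p<n. \<Sum>q<n. f p q) = (\<Sum>p\<in>{i, k}. \<Sum>q\<in>{i, k}. f p q)"
    using assms by (intro sum.mono_neutral_cong_right sum.neutral) auto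
  then show ?thesis using assms(3) by (simp add: add.assoc)
qed

lemma psd_diagonal:
  assumes "psd n H" "k < n"
  shows "H k k = complex_of_real (Re (H k k))" "0 \<le> Re (H k k)"
proof -
  show "H k k = complex_of_real (Re (H k k))"
    using psdD(1)[OF assms(1), of k k] assms(2) by (simp add: complex_eq_iff)
  define \<mu> :: "nat \<Rightarrow> complex" where "\<mu> p = (if p = k then 1 else 0)" for p
  have "(\<Sum>i<n. \<Sum>j<n. cnj (\<mu> i) * H i j * \<mu> j) = (\<Sum>p\<in>{k}. \<Sum>q\<in>{k}. H p q)"
    using assms(2) by (intro sum.mono_neutral_cong_right sum.neutral) (auto simp: \<mu>_def)
  then show "0 \<le> Re (H k k)"
    using psdD(2)[OF assms(1), of \<mu>] by simp
qed

lemma psd_zero_diagonal: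
  assumes H: "psd n H" and i: "i < n" and k: "k < n" and zero: "H k k = 0"
  shows "H i k = 0" "H k i = 0"
proof -
  show "H i k = 0"
  proof (rule ccontr)
    assume ne: "H i k \<noteq> 0"
    then have ik: "i \<noteq> k" using zero by auto
    have herm: "H k i = cnj (H i k)" using psdD(1)[OF H i k] .
    define m where "m = (cmod (H i k))\<^sup>2"
    have m: "0 < m" using ne by (simp add: m_def)
    \<comment> \<open>Along \<open>e\<^sub>i - r H\<^sub>k\<^sub>i e\<^sub>k\<close> the form is affine in \<open>r\<close> with slope \<open>- 2 m\<close>; any large \<open>r\<close> works.\<close>
    define r where "r = Re (H i i) / m + 1"
    define \<mu> where "\<mu> p = (if p = i then 1 else if p = k then - complex_of_real r * H k i else 0)" for p
    have "(\<Sum>p<n. \<Sum>q<n. cnj (\<mu> p) * H p q * \<mu> q) = H i i - 2 * complex_of_real (r * m)"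
      using ik i k zero complex_norm_square[of "H i k"]
      by (subst sum2_two_points[of i n k]) (auto simp: \<mu>_def herm m_def mult_ac)
    then have "0 \<le> Re (H i i) - 2 * (r * m)"
      using psdD(2)[OF H, of \<mu>] by simp
    moreover have "r * m = Re (H i i) + m" using m by (simp add: r_def field_simps)
    ultimately show False using m psd_diagonal(2)[OF H i] by linarith
  qed
  then show "H k i = 0" using psdD(1)[OF H i k] by simp
qed

lemma sum2_extend:
  fixes f :: "nat \<Rightarrow> nat \<Rightarrow> 'b::comm_monoid_add"
  assumes "\<And>i. i \<le> n \<Longrightarrow> f i n = 0" "\<And>j. j \<le> n \<Longrightarrow> f n j = 0"
  shows "(\<Sum>i<Suc n. \<Sum>j<Suc n. f i j) = (\<Sum>i<n. \<Sum>j<n. f i j)"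
  using assms by (simp add: sum.distrib)

lemma rank_one_sum:
  fixes H g :: "nat \<Rightarrow> nat \<Rightarrow> complex"
  shows "(\<Sum>i<m. \<Sum>j<m. H i j * g i j) =
    (\<Sum>i<m. \<Sum>j<m. (H i j - H i k * H k j / H k k) * g i j) +
    (\<Sum>i<m. \<Sum>j<m. H i k * g i j * H k j) / H k k"
proof -
  have "H i j * g i j = (H i j - H i k * H k j / H k k) * g i j + H i k * g i j * H k j / H k k" for i j
    by (simp add: left_diff_distrib)
  then show ?thesis
    by (simp only: sum_divide_distrib sum.distrib)
qed

text \<open>This is Schur's product theorem, with one factor merely accretive. Splitting off the rank
  one matrix \<open>H i n * H n j / H n n\<close> leaves a semidefinite Schur complement of smaller size, and
  against a rank one matrix the sum is a value of the quadratic form of \<open>G\<close>.\<close>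

lemma schur_product_nonneg:
  assumes "psd n H" and "\<And>\<mu>. 0 \<le> Re (\<Sum>i<n. \<Sum>j<n. cnj (\<mu> i) * G i j * \<mu> j)"
  shows "0 \<le> Re (\<Sum>i<n. \<Sum>j<n. H i j * G i j)"
  using assms
proof (induction n arbitrary: H)
  case (Suc n)
  note H = Suc.prems(1)
  define d where "d = Re (H n n)"
  have d: "H n n = complex_of_real d" "0 \<le> d"
    unfolding d_def by (rule psd_diagonal[OF H lessI])+
  have herm: "H j i = cnj (H i j)" if "i \<le> n" "j \<le> n" for i j
    by (rule psdD(1)[OF H]) (use that in auto)
  have zero: "H i n = 0" "H n i = 0" if "d = 0" "i \<le> n" for i
    using psd_zero_diagonal[OF H, of i n] that d(1) by (auto simp: less_Suc_eq_le)
  define H' where "H' i j = H i j - H i n * H n j / H n n" for i j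
  have H'0: "H' i n = 0" "H' n i = 0" if "i \<le> n" for i
    using zero[OF _ that] d by (cases "d = 0"; simp add: H'_def)+
  have "psd n H'"
    unfolding psd_def
  proof (intro conjI allI impI)
    fix i j assume "i < n" "j < n"
    then show "H' j i = cnj (H' i j)"
      using herm[of i j] herm[of i n] herm[of n j] d by (simp add: H'_def mult.commute)
  next
    fix \<mu> :: "nat \<Rightarrow> complex"
    \<comment> \<open>The last coordinate is chosen so that the rank one part vanishes at \<open>\<nu>\<close>. For \<open>H n n = 0\<close>
      division by zero makes it 0, which is right because then the last row vanishes.\<close>
    define \<nu> where "\<nu> = \<mu>(n := - (\<Sum>j<n. H n j * \<mu> j) / H n n)"
    have \<nu>0: "(\<Sum>j<Suc n. H n j * \<nu> j) / H n n = 0"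
      using zero d by (cases "d = 0") (auto simp: \<nu>_def)
    have "(\<Sum>i<Suc n. \<Sum>j<Suc n. cnj (\<nu> i) * H i j * \<nu> j) =
        (\<Sum>i<Suc n. \<Sum>j<Suc n. H i j * (cnj (\<nu> i) * \<nu> j))"
      by (simp add: mult_ac)
    also have "\<dots> = (\<Sum>i<Suc n. \<Sum>j<Suc n. H' i j * (cnj (\<nu> i) * \<nu> j)) +
        (\<Sum>i<Suc n. \<Sum>j<Suc n. H i n * (cnj (\<nu> i) * \<nu> j) * H n j) / H n n"
      unfolding H'_def by (rule rank_one_sum)
    also have "(\<Sum>i<Suc n. \<Sum>j<Suc n. H i n * (cnj (\<nu> i) * \<nu> j) * H n j) / H n n =
        (\<Sum>i<Suc n. H i n * cnj (\<nu> i)) * ((\<Sum>j<Suc n. H n j * \<nu> j) / H n n)"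
      by (simp only: sum_product times_divide_eq_right) (simp only: mult_ac)
    also have "\<dots> = 0" unfolding \<nu>0 by simp
    also have "(\<Sum>i<Suc n. \<Sum>j<Suc n. H' i j * (cnj (\<nu> i) * \<nu> j)) =
        (\<Sum>i<n. \<Sum>j<n. H' i j * (cnj (\<nu> i) * \<nu> j))"
      by (rule sum2_extend) (auto simp: H'0)
    also have "\<dots> = (\<Sum>i<n. \<Sum>j<n. cnj (\<mu> i) * H' i j * \<mu> j)"
      by (intro sum.cong refl) (simp add: \<nu>_def)
    finally show "0 \<le> Re (\<Sum>i<n. \<Sum>j<n. cnj (\<mu> i) * H' i j * \<mu> j)"
      using psdD(2)[OF H, of \<nu>] by simp
  qed
  moreover have "0 \<le> Re (\<Sum>i<n. \<Sum>j<n. cnj (\<mu> i) * G i j * \<mu> j)" for \<mu>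
  proof -
    have "(\<Sum>i<Suc n. \<Sum>j<Suc n. cnj ((\<mu>(n := 0)) i) * G i j * (\<mu>(n := 0)) j) =
        (\<Sum>i<n. \<Sum>j<n. cnj ((\<mu>(n := 0)) i) * G i j * (\<mu>(n := 0)) j)"
      by (rule sum2_extend) auto
    also have "\<dots> = (\<Sum>i<n. \<Sum>j<n. cnj (\<mu> i) * G i j * \<mu> j)"
      by (intro sum.cong refl) simp
    finally show ?thesis using Suc.prems(2)[of "\<mu>(n := 0)"] by simp
  qed
  ultimately have IH: "0 \<le> Re (\<Sum>i<n. \<Sum>j<n. H' i j * G i j)"
    by (rule Suc.IH)
  have "(\<Sum>i<Suc n. \<Sum>j<Suc n. H i j * G i j) = (\<Sum>i<Suc n. \<Sum>j<Suc n. H' i j * G i j) +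
      (\<Sum>i<Suc n. \<Sum>j<Suc n. H i n * G i j * H n j) / H n n"
    unfolding H'_def by (rule rank_one_sum)
  also have "(\<Sum>i<Suc n. \<Sum>j<Suc n. H' i j * G i j) = (\<Sum>i<n. \<Sum>j<n. H' i j * G i j)"
    by (rule sum2_extend) (auto simp: H'0)
  also have "(\<Sum>i<Suc n. \<Sum>j<Suc n. H i n * G i j * H n j) =
      (\<Sum>i<Suc n. \<Sum>j<Suc n. cnj (H n i) * G i j * H n j)"
    by (intro sum.cong refl) (simp add: herm[of n, symmetric] less_Suc_eq_le)
  finally have "Re (\<Sum>i<Suc n. \<Sum>j<Suc n. H i j * G i j) = Re (\<Sum>i<n. \<Sum>j<n. H' i j * G i j) +
      Re (\<Sum>i<Suc n. \<Sum>j<Suc n. cnj (H n i) * G i j * H n j) / d"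
    unfolding d(1) by (simp only: plus_complex.simps Re_divide_of_real)
  then show ?case
    using IH Suc.prems(2)[of "H n"] d(2) by (simp only: add_nonneg_nonneg divide_nonneg_nonneg)
qed simp

lemma psd_tensor_accretive:
  assumes D: "D \<in> bounded_operators" "\<And>x. 0 \<le> Re (cinner x (D x))" and H: "psd n H"
  shows "0 \<le> re_form n (\<lambda>i j. op_scaleC (H i j) D) v"
proof -
  have "0 \<le> Re (\<Sum>i<n. \<Sum>j<n. cnj (\<mu> i) * cinner (v i) (D (v j)) * \<mu> j)" for \<mu>
  proof -
    have "D (\<mu> j *\<^sub>C v j) = \<mu> j *\<^sub>C D (v j)" for j
      using D(1) by (simp add: bounded_operators_def)
    then have "(\<Sum>i<n. \<Sum>j<n. cnj (\<mu> i) * cinner (v i) (D (v j)) * \<mu> j) =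
        cinner (\<Sum>i<n. \<mu> i *\<^sub>C v i) (D (\<Sum>j<n. \<mu> j *\<^sub>C v j))"
      by (simp add: blinfun.sum_right cinner_sum_left cinner_scaleC_left)
        (simp add: cinner_sum_right cinner_scaleC_right sum_distrib_left mult_ac)
    then show ?thesis using D(2) by simp
  qed
  then have "0 \<le> Re (\<Sum>i<n. \<Sum>j<n. H i j * cinner (v i) (D (v j)))"
    by (rule schur_product_nonneg[OF H])
  then show ?thesis
    by (simp add: re_form_def cinner_scaleC_right)
qed

lemma skew_tensor_symmetric:
  fixes D :: "'h::chilbert_space \<Rightarrow>\<^sub>L 'h"
  assumes D: "\<And>x y. cinner x (D y) = cinner (D x) y" and K: "\<And>i j. i < n \<Longrightarrow> j < n \<Longrightarrow> K j i = - cnj (K i j)"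
  shows "re_form n (\<lambda>i j. op_scaleC (K i j) D) v = 0"
proof -
  have swap: "Re (cinner (v i) (op_scaleC (K i j) D (v j))) = - Re (cinner (v j) (op_scaleC (K j i) D (v i)))"
    if "i < n" "j < n" for i j
  proof -
    have "cinner (v j) (D (v i)) = cnj (cinner (v i) (D (v j)))"
      by (metis D cinner_commute)
    then show ?thesis
      using K[OF that] by (simp add: cinner_scaleC_right)
  qed
  have "re_form n (\<lambda>i j. op_scaleC (K i j) D) v =
      (\<Sum>i<n. \<Sum>j<n. - Re (cinner (v j) (op_scaleC (K j i) D (v i))))"
    unfolding re_form_def by (intro sum.cong refl swap) auto
  also have "\<dots> = - re_form n (\<lambda>i j. op_scaleC (K i j) D) v"
    unfolding re_form_def sum_negf by (subst sum.swap) simp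
  finally show ?thesis by simp
qed

section \<open>Almost accretive matrices\<close>

abbreviation mat_diag :: "('h::chilbert_space \<Rightarrow>\<^sub>L 'h) \<Rightarrow> nat \<Rightarrow> nat \<Rightarrow> 'h \<Rightarrow>\<^sub>L 'h"
  where "mat_diag g i j \<equiv> (if i = j then g else 0)"

lemma re_form_diag: "re_form n (mat_diag g) v = (\<Sum>i<n. Re (cinner (v i) (g (v i))))"
proof -
  have "(\<Sum>j<n. Re (cinner (v i) (mat_diag g i j (v j)))) = Re (cinner (v i) (g (v i)))" if "i < n" for i
  proof -
    have "(\<Sum>j<n. Re (cinner (v i) (mat_diag g i j (v j)))) =
        (\<Sum>j<n. if i = j then Re (cinner (v i) (g (v i))) else 0)"
      by (intro sum.cong refl) auto
    then show ?thesis using that by simp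
  qed
  then show ?thesis unfolding re_form_def by simp
qed

lemma re_form_diag_bound:
  assumes "norm g \<le> K"
  shows "\<bar>re_form n (mat_diag g) v\<bar> \<le> K * (vec_norm n v)\<^sup>2"
proof -
  have "\<bar>Re (cinner (v i) (g (v i)))\<bar> \<le> K * (norm (v i))\<^sup>2" for i
  proof -
    have "\<bar>Re (cinner (v i) (g (v i)))\<bar> \<le> norm (v i) * norm (g (v i))"
      using abs_Re_le_cmod cinner_le_norm order_trans by blast
    also have "\<dots> \<le> norm (v i) * (K * norm (v i))"
      by (rule mult_left_mono[OF norm_blinfun_le[OF assms]]) simp
    finally show ?thesis by (simp add: power2_eq_square mult_ac)
  qed
  then show ?thesis
    unfolding re_form_diag vec_norm_sq sum_distrib_left
    by (intro order_trans[OF sum_abs] sum_mono)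
qed

lemma re_form_diag_diff:
  "re_form n (mat_diag (g - g')) v = re_form n (mat_diag g) v - re_form n (mat_diag g') v"
  by (simp add: re_form_diag blinfun.diff_left cinner_diff_right sum_subtractf)

text \<open>Compressing the accretive matrix \<open>z + d\<close> gives \<open>f\<close> in the unit ball for which
  \<open>z + d f\<close> is almost accretive with half the defect of \<open>z\<close>; the corrections
  \<open>d f\<^sub>0, (d/2) f\<^sub>1, \<dots>\<close> sum to \<open>g\<close>.\<close>

lemma accretive_correction:
  assumes A: "operator_algebra A" "approximately_unital A"
    and z: "z \<in> matrices n A" and d: "0 < d" and pos: "\<And>v. - d * (vec_norm n v)\<^sup>2 \<le> re_form n z v"
  shows "\<exists>g\<in>A. norm g \<le> 2 * d \<and> (\<forall>v. 0 \<le> re_form n (\<lambda>i j. z i j + mat_diag g i j) v)"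
proof -
  define good where "good k g \<longleftrightarrow> g \<in> A \<and>
    (\<forall>v. - (d / 2 ^ k) * (vec_norm n v)\<^sup>2 \<le> re_form n z v + re_form n (mat_diag g) v)" for k :: nat and g
  have step: "\<exists>g'. good (Suc k) g' \<and> norm (g' - g) \<le> d / 2 ^ k" if g: "good k g" for k g
  proof -
    define t where "t = d / 2 ^ k"
    have t: "0 < t" using d by (simp add: t_def)
    define y where "y i j = z i j + mat_diag g i j" for i j
    have y: "re_form n y v = re_form n z v + re_form n (mat_diag g) v" for v
      unfolding y_def by (rule re_form_add)
    have yA: "y \<in> matrices n A"
      using z g operator_algebraD(3,4)[OF A(1)] by (auto simp: y_def matrices_def good_def)
    define c where "c i j = (if i = j then complex_of_real t else 0)" for i j :: nat
    have c: "(\<lambda>i j. y i j + op_scaleC (c i j) T) = (\<lambda>i j. y i j + mat_diag (t *\<^sub>R T) i j)" for T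
      by (intro ext) (simp add: c_def op_scaleC_of_real)
    have id: "re_form n (mat_diag (t *\<^sub>R id_blinfun)) v = t * (vec_norm n v)\<^sup>2" for v :: "nat \<Rightarrow> 'a"
      unfolding re_form_diag vec_norm_sq sum_distrib_left
      by (simp add: blinfun.scaleR_left cinner_scaleR_right Re_cinner_self)
    have pos_y: "0 \<le> re_form n (\<lambda>i j. y i j + op_scaleC (c i j) id_blinfun) v" for v
      using g[unfolded good_def t_def[symmetric], THEN conjunct2, rule_format, of v]
      unfolding c re_form_add id y by simp
    have "0 < t / 2" using t by simp
    from accretive_compression[OF A yA this pos_y]
    obtain f where f: "f \<in> A" "norm f \<le> 1"
      "\<And>v. - (t / 2) * (vec_norm n v)\<^sup>2 \<le> re_form n (\<lambda>i j. y i j + op_scaleC (c i j) f) v"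
      by blast
    have "re_form n (mat_diag (g + t *\<^sub>R f)) v = re_form n (mat_diag g) v + re_form n (mat_diag (t *\<^sub>R f)) v" for v
      by (simp add: re_form_diag blinfun.add_left cinner_add_right sum.distrib)
    then have "good (Suc k) (g + t *\<^sub>R f)"
      using f g operator_algebraD(4,6)[OF A(1)] unfolding good_def c re_form_add y t_def
      by (simp add: algebra_simps)
    moreover have "norm ((g + t *\<^sub>R f) - g) \<le> d / 2 ^ k"
      using f(2) d t mult_left_mono[of "norm f" 1 t] by (simp add: t_def)
    ultimately show ?thesis by blast
  qed
  have "good 0 0"
    using pos operator_algebraD(3)[OF A(1)] by (simp add: good_def re_form_def)
  then have "\<exists>G. \<forall>k. ((k = 0 \<longrightarrow> G k = 0) \<and> good k (G k)) \<and> norm (G (Suc k) - G k) \<le> d / 2 ^ k"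
    using step by (intro dependent_nat_choice) auto
  then obtain G where G: "G 0 = 0" "\<And>k. good k (G k)" "\<And>k. norm (G (Suc k) - G k) \<le> d / 2 ^ k"
    by blast
  have geometric: "(\<lambda>k. d / 2 ^ k) sums (2 * d)"
    using sums_mult[OF geometric_sums[of "1/2 :: real"], of d] by (simp add: power_divide mult.commute)
  have summable: "summable (\<lambda>k. norm (G (Suc k) - G k))"
    by (rule summable_comparison_test'[OF sums_summable[OF geometric]]) (use G(3) in auto)
  define g where "g = (\<Sum>k. G (Suc k) - G k)"
  have "(\<lambda>m. \<Sum>k<m. G (Suc k) - G k) \<longlonglongrightarrow> g"
    unfolding g_def using summable_norm_cancel[OF summable] by (rule summable_LIMSEQ)
  then have lim: "G \<longlonglongrightarrow> g"
    by (simp add: sum_lessThan_telescope G(1))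
  have "g \<in> A"
    using closed_sequentially[OF operator_algebraD(2)[OF A(1)] _ lim] G(2) by (simp add: good_def)
  moreover have "norm g \<le> 2 * d"
    unfolding g_def sums_unique[OF geometric]
    by (rule order_trans[OF summable_norm[OF summable] suminf_le[OF G(3) summable sums_summable[OF geometric]]])
  moreover have "0 \<le> re_form n (\<lambda>i j. z i j + mat_diag g i j) v" for v
  proof -
    have "- (d / 2 ^ k) * (vec_norm n v)\<^sup>2 - norm (g - G k) * (vec_norm n v)\<^sup>2 \<le>
        re_form n (\<lambda>i j. z i j + mat_diag g i j) v" for k
      using G(2)[of k] re_form_diag_bound[of "g - G k" "norm (g - G k)" n v]
      unfolding good_def re_form_add re_form_diag_diff
      by (elim conjE allE[of _ v]) linarith
    moreover have "(\<lambda>k. - (d / 2 ^ k) * (vec_norm n v)\<^sup>2 - norm (g - G k) * (vec_norm n v)\<^sup>2) \<longlonglongrightarrow>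
        - 0 * (vec_norm n v)\<^sup>2 - norm (g - g) * (vec_norm n v)\<^sup>2"
      by (intro tendsto_intros lim summable_LIMSEQ_zero[OF sums_summable[OF geometric]])
    ultimately have "- 0 * (vec_norm n v)\<^sup>2 - norm (g - g) * (vec_norm n v)\<^sup>2 \<le>
        re_form n (\<lambda>i j. z i j + mat_diag g i j) v"
      by (intro LIMSEQ_le_const2) auto
    then show ?thesis by simp
  qed
  ultimately show ?thesis by blast
qed

text \<open>An almost accretive matrix is moved into the accretive cone by a small element of the algebra
  itself, and there real positivity of \<open>P\<close> applies.\<close>

lemma positive_map_almost_accretive:
  assumes A: "operator_algebra A" "approximately_unital A"
    and P: "map_on A P" "real_completely_positive A P" "\<And>a. a \<in> A \<Longrightarrow> norm (P a) \<le> norm a"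
    and z: "z \<in> matrices n A" and d: "0 < d" and pos: "\<And>v. - d * (vec_norm n v)\<^sup>2 \<le> re_form n z v"
  shows "- 2 * d * (vec_norm n v)\<^sup>2 \<le> re_form n (\<lambda>i j. P (z i j)) v"
proof -
  note AD = operator_algebraD[OF A(1)]
  obtain g where g: "g \<in> A" "norm g \<le> 2 * d" "\<And>v. 0 \<le> re_form n (\<lambda>i j. z i j + mat_diag g i j) v"
    using accretive_correction[OF A z d pos] by blast
  have P0: "P 0 = 0" using P(3)[OF AD(3)] by simp
  have "(\<lambda>i j. z i j + mat_diag g i j) \<in> real_positive n A"
    using z g AD(3,4) by (auto simp: real_positive_iff[OF AD(1)] matrices_def)
  then have "amplification P (\<lambda>i j. z i j + mat_diag g i j) \<in> real_positive n A"
    using P(2) unfolding real_completely_positive_def by blast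
  then have "0 \<le> re_form n (amplification P (\<lambda>i j. z i j + mat_diag g i j)) v"
    by (simp add: real_positive_iff[OF AD(1)])
  also have "\<dots> = re_form n (\<lambda>i j. P (z i j) + mat_diag (P g) i j) v"
    using P(1) P0 z g(1) AD(3)
    by (intro re_form_cong) (auto simp: amplification_def map_on_def matrices_def)
  also have "\<dots> = re_form n (\<lambda>i j. P (z i j)) v + re_form n (mat_diag (P g)) v"
    by (rule re_form_add)
  finally show ?thesis
    using re_form_diag_bound[of "P g" "2 * d" n v] order_trans[OF P(3)[OF g(1)] g(2)] by simp
qed

text \<open>Write \<open>I = f + (I - f)\<close> with \<open>f\<close> from the compression: the map is controlled on
  \<open>a + H \<otimes> f\<close>, while \<open>H \<otimes> (I - P f)\<close> is accretive because \<open>P f\<close> is a contraction.\<close>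

lemma positive_map_psd_extension:
  assumes A: "operator_algebra A" "approximately_unital A"
    and P: "map_on A P" "real_completely_positive A P" "\<And>a. a \<in> A \<Longrightarrow> norm (P a) \<le> norm a"
    and a: "a \<in> matrices n A" and H: "psd n H"
    and pos: "\<And>v. 0 \<le> re_form n (\<lambda>i j. a i j + op_scaleC (H i j) id_blinfun) v"
  shows "0 \<le> re_form n (\<lambda>i j. P (a i j) + op_scaleC (H i j) id_blinfun) v"
proof -
  note AD = operator_algebraD[OF A(1)]
  have "0 \<le> re_form n (\<lambda>i j. P (a i j) + op_scaleC (H i j) id_blinfun) v + 2 * \<eta> * (vec_norm n v)\<^sup>2"
    if \<eta>: "0 < \<eta>" for \<eta>
  proof -
    obtain f where f: "f \<in> A" "norm f \<le> 1"
      "\<And>v. - \<eta> * (vec_norm n v)\<^sup>2 \<le> re_form n (\<lambda>i j. a i j + op_scaleC (H i j) f) v"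
      using accretive_compression[OF A a \<eta> pos] by blast
    have Pf: "P f \<in> A" "norm (P f) \<le> 1"
      using P(1,3) f(1,2) by (auto simp: map_on_def intro: order_trans)
    have "(\<lambda>i j. a i j + op_scaleC (H i j) f) \<in> matrices n A"
      using a f(1) AD(4,5) by (auto simp: matrices_def)
    from positive_map_almost_accretive[OF A P this \<eta> f(3)]
    have "- 2 * \<eta> * (vec_norm n v)\<^sup>2 \<le> re_form n (\<lambda>i j. P (a i j + op_scaleC (H i j) f)) v" .
    also have "\<dots> = re_form n (\<lambda>i j. P (a i j) + op_scaleC (H i j) (P f)) v"
      using a P(1) f(1) AD(5) by (intro re_form_cong) (auto simp: map_on_def matrices_def)
    also have "\<dots> = re_form n (\<lambda>i j. P (a i j)) v + re_form n (\<lambda>i j. op_scaleC (H i j) (P f)) v"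
      by (rule re_form_add)
    finally have 1: "- 2 * \<eta> * (vec_norm n v)\<^sup>2 \<le> \<dots>" .
    have "0 \<le> re_form n (\<lambda>i j. op_scaleC (H i j) (id_blinfun - P f)) v"
    proof (rule psd_tensor_accretive[OF _ _ H])
      show "id_blinfun - P f \<in> bounded_operators"
        using Pf(1) AD(1) by (auto simp: bounded_operators_def blinfun.diff_left scaleC_diff_right)
      fix x
      have "Re (cinner x (P f x)) \<le> norm x * norm x"
        using complex_Re_le_cmod[of "cinner x (P f x)"] cinner_le_norm[of x "P f x"]
          mult_left_mono[OF norm_contraction_le[OF Pf(2), of x] norm_ge_zero[of x]] by linarith
      then show "0 \<le> Re (cinner x ((id_blinfun - P f) x))"
        by (simp add: blinfun.diff_left cinner_diff_right Re_cinner_self power2_eq_square)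
    qed
    also have "\<dots> = re_form n (\<lambda>i j. op_scaleC (H i j) id_blinfun) v - re_form n (\<lambda>i j. op_scaleC (H i j) (P f)) v"
      by (simp add: re_form_def blinfun.diff_left cinner_diff_right cinner_scaleC_right
          right_diff_distrib sum_subtractf)
    finally show ?thesis
      using 1 unfolding re_form_add by linarith
  qed
  note * = this
  have "(\<lambda>k. re_form n (\<lambda>i j. P (a i j) + op_scaleC (H i j) id_blinfun) v
      + 2 * (1 / real (Suc k)) * (vec_norm n v)\<^sup>2) \<longlonglongrightarrow>
      re_form n (\<lambda>i j. P (a i j) + op_scaleC (H i j) id_blinfun) v + 2 * 0 * (vec_norm n v)\<^sup>2"
    by (intro tendsto_intros LIMSEQ_Suc[OF lim_1_over_n])
  moreover have "0 \<le> re_form n (\<lambda>i j. P (a i j) + op_scaleC (H i j) id_blinfun) v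
      + 2 * (1 / real (Suc k)) * (vec_norm n v)\<^sup>2" for k
    by (rule *) simp
  ultimately have "0 \<le> re_form n (\<lambda>i j. P (a i j) + op_scaleC (H i j) id_blinfun) v + 2 * 0 * (vec_norm n v)\<^sup>2"
    by (intro LIMSEQ_le_const) auto
  then show ?thesis by simp
qed

section \<open>Operator norms of matrices\<close>

lemma vec_norm_mat_apply_bound: "vec_norm n (mat_apply n X v) \<le> (\<Sum>i<n. \<Sum>j<n. norm (X i j)) * vec_norm n v"
proof -
  have "norm (mat_apply n X v i) \<le> (\<Sum>j<n. norm (X i j)) * vec_norm n v" for i
  proof -
    have "norm (X i j (v j)) \<le> norm (X i j) * vec_norm n v" if "j < n" for j
      using norm_blinfun[of "X i j" "v j"] mult_left_mono[OF norm_le_vec_norm[OF that, of v], of "norm (X i j)"]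
      by simp
    then show ?thesis
      unfolding mat_apply_def sum_distrib_right by (intro order_trans[OF norm_sum] sum_mono) auto
  qed
  moreover have "vec_norm n (mat_apply n X v) \<le> (\<Sum>i<n. norm (mat_apply n X v i))"
    unfolding vec_norm_def L2_set_def[symmetric] by (rule L2_set_le_sum) simp
  ultimately show ?thesis
    unfolding sum_distrib_right[of _ "{..<n}" "vec_norm n v"] by (meson order_trans sum_mono)
qed

lemma mat_apply_scaleR: "mat_apply n X (\<lambda>i. r *\<^sub>R v i) = (\<lambda>i. r *\<^sub>R mat_apply n X v i)"
  by (auto simp: mat_apply_def blinfun.scaleR_right scaleR_sum_right)

lemma vec_norm_scaleR: "vec_norm n (\<lambda>i. r *\<^sub>R v i) = \<bar>r\<bar> * vec_norm n v"
  by (simp add: vec_norm_def power_mult_distrib flip: sum_distrib_left) (simp add: real_sqrt_mult)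

lemma mat_norm_bdd: "bdd_above ((\<lambda>v. vec_norm n (mat_apply n X v)) ` {v. vec_norm n v \<le> 1})"
proof (rule bdd_aboveI2)
  fix v :: "nat \<Rightarrow> 'a" assume "v \<in> {v. vec_norm n v \<le> 1}"
  then have "(\<Sum>i<n. \<Sum>j<n. norm (X i j)) * vec_norm n v \<le> (\<Sum>i<n. \<Sum>j<n. norm (X i j)) * 1"
    by (intro mult_left_mono sum_nonneg) auto
  then show "vec_norm n (mat_apply n X v) \<le> (\<Sum>i<n. \<Sum>j<n. norm (X i j))"
    using vec_norm_mat_apply_bound[of n X v] by simp
qed

lemma mat_norm_apply: "vec_norm n (mat_apply n X v) \<le> mat_norm n X * vec_norm n v"
proof (cases "vec_norm n v = 0")
  case True
  then show ?thesis using vec_norm_mat_apply_bound[of n X v] by simp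
next
  case False
  define r where "r = vec_norm n v"
  have r: "0 < r" using False vec_norm_nonneg[of n v] unfolding r_def by linarith
  have "vec_norm n (mat_apply n X (\<lambda>i. (1 / r) *\<^sub>R v i)) \<le> mat_norm n X"
    unfolding mat_norm_def
    by (rule cSUP_upper[OF _ mat_norm_bdd]) (use r in \<open>simp add: vec_norm_scaleR r_def\<close>)
  then show ?thesis
    using r by (simp add: mat_apply_scaleR vec_norm_scaleR field_simps flip: r_def)
qed

lemma mat_norm_nonneg: "0 \<le> mat_norm n X"
proof -
  have "vec_norm n (mat_apply n X (\<lambda>_. 0)) \<le> mat_norm n X"
    unfolding mat_norm_def by (rule cSUP_upper[OF _ mat_norm_bdd]) (simp add: vec_norm_def)
  then show ?thesis using vec_norm_nonneg order_trans by blast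
qed

lemma mat_norm_leI:
  assumes "\<And>v. vec_norm n (mat_apply n X v) \<le> K * vec_norm n v" "0 \<le> K"
  shows "mat_norm n X \<le> K"
  unfolding mat_norm_def
proof (rule cSUP_least)
  have "vec_norm n (\<lambda>_. 0 :: 'a) \<le> 1" by (simp add: vec_norm_def)
  then show "{v :: nat \<Rightarrow> 'a. vec_norm n v \<le> 1} \<noteq> {}" by blast
  fix v :: "nat \<Rightarrow> 'a" assume "v \<in> {v. vec_norm n v \<le> 1}"
  then show "vec_norm n (mat_apply n X v) \<le> K"
    using assms(1)[of v] mult_left_mono[of "vec_norm n v" 1 K] assms(2) by simp
qed

lemma mat_norm_one: "mat_norm 1 (\<lambda>i j. T) = norm T"
proof (rule antisym)
  show "mat_norm 1 (\<lambda>i j. T) \<le> norm T"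
    by (rule mat_norm_leI) (auto simp: vec_norm_def mat_apply_def norm_blinfun)
  show "norm T \<le> mat_norm 1 (\<lambda>i j. T)"
  proof (rule norm_blinfun_bound[OF mat_norm_nonneg])
    show "norm (T x) \<le> mat_norm 1 (\<lambda>i j. T) * norm x" for x
      using mat_norm_apply[of 1 "\<lambda>i j. T" "\<lambda>_. x"] by (simp add: vec_norm_def mat_apply_def)
  qed
qed

lemma completely_contractive_norm:
  assumes "completely_contractive A P" "a \<in> A"
  shows "norm (P a) \<le> norm a"
proof -
  have "mat_norm 1 (amplification P (\<lambda>i j. a)) \<le> mat_norm 1 (\<lambda>i j. a)"
    using assms unfolding completely_contractive_def matrices_def by blast
  then show ?thesis
    by (simp only: amplification_def[abs_def] mat_norm_one)
qed

lemma vec_cinner_le: "Re (vec_cinner n v w) \<le> vec_norm n v * vec_norm n w"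
proof -
  have "Re (vec_cinner n v w) \<le> (\<Sum>i<n. norm (v i) * norm (w i))"
    unfolding vec_cinner_def Re_sum
    using complex_Re_le_cmod cinner_le_norm order_trans by (blast intro: sum_mono)
  also have "\<dots> \<le> vec_norm n v * vec_norm n w"
    using L2_set_mult_ineq[of "\<lambda>i. norm (v i)" "\<lambda>i. norm (w i)" "{..<n}"]
    by (simp add: L2_set_def vec_norm_def)
  finally show ?thesis .
qed

section \<open>Unital real completely positive maps are completely contractive\<close>

lemma sum_lessThan_add: "(\<Sum>i<m + n. f i) = (\<Sum>i<m. f i) + (\<Sum>i<n. f (m + i))"
  for f :: "nat \<Rightarrow> 'b::comm_monoid_add"
  by (induction n) (auto simp: add.assoc)

text \<open>The \<open>2 \<times> 2\<close> block matrix with diagonal blocks \<open>u \<otimes> I\<close>, upper right block \<open>2 X\<close> and lower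
  left block 0.\<close>

definition corner_matrix ::
  "nat \<Rightarrow> ('h::chilbert_space \<Rightarrow>\<^sub>L 'h) \<Rightarrow> (nat \<Rightarrow> nat \<Rightarrow> 'h \<Rightarrow>\<^sub>L 'h) \<Rightarrow> nat \<Rightarrow> nat \<Rightarrow> 'h \<Rightarrow>\<^sub>L 'h"
  where "corner_matrix n u X i j =
    (if i = j then u else if i < n \<and> n \<le> j then 2 *\<^sub>R X i (j - n) else 0)"

lemma re_form_corner:
  "re_form (n + n) (corner_matrix n u X) v = re_form (n + n) (mat_diag u) v +
    2 * Re (vec_cinner n v (mat_apply n X (\<lambda>j. v (n + j))))"
proof -
  define Y where "Y i j = (if i < n \<and> n \<le> j then 2 *\<^sub>R X i (j - n) else 0)" for i j
  have "re_form (n + n) (corner_matrix n u X) v = re_form (n + n) (\<lambda>i j. mat_diag u i j + Y i j) v"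
    by (rule re_form_cong) (auto simp: corner_matrix_def Y_def)
  also have "\<dots> = re_form (n + n) (mat_diag u) v + re_form (n + n) Y v"
    by (rule re_form_add)
  also have "re_form (n + n) Y v = 2 * Re (vec_cinner n v (mat_apply n X (\<lambda>j. v (n + j))))"
    by (simp add: re_form_def sum_lessThan_add Y_def blinfun.scaleR_left cinner_scaleR_right
        vec_cinner_def mat_apply_def cinner_sum_right sum_distrib_left)
  finally show ?thesis .
qed

text \<open>Off the diagonal, accretivity is a norm bound: for a projection \<open>u\<close> that is a unit for the
  entries of \<open>X\<close>, the \<open>2 \<times> 2\<close> block matrix with \<open>m u\<close> on the diagonal and \<open>2 X\<close> in one corner
  is accretive as soon as \<open>\<parallel>X\<parallel> \<le> m\<close>; and if it is accretive, testing with
  \<open>(- X w, m w)\<close> gives \<open>\<parallel>X w\<parallel> \<le> m \<parallel>w\<parallel>\<close>.\<close>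

lemma unital_real_positive_contractive:
  assumes B: "B \<subseteq> bounded_operators" "\<And>c a. a \<in> B \<Longrightarrow> op_scaleC c a \<in> B"
    and Q: "map_on B Q" "real_completely_positive B Q"
    and u: "is_identity B u" "Q u = u" "\<And>x y. cinner x (u y) = cinner (u x) (u y)"
  shows "completely_contractive B Q"
  unfolding completely_contractive_def
proof (intro allI ballI mat_norm_leI)
  fix n and X :: "nat \<Rightarrow> nat \<Rightarrow> 'a \<Rightarrow>\<^sub>L 'a" and w
  assume X: "X \<in> matrices n B"
  show "0 \<le> mat_norm n X" by (rule mat_norm_nonneg)
  have uB: "u \<in> B" and unit: "\<And>a x. a \<in> B \<Longrightarrow> u (a x) = a x" "\<And>a x. a \<in> B \<Longrightarrow> a (u x) = a x"
    using u(1) unfolding is_identity_def by (auto simp flip: blinfun_apply_blinfun_compose)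
  have scaleR: "r *\<^sub>R a \<in> B" "Q (r *\<^sub>R a) = r *\<^sub>R Q a" if "a \<in> B" for r a
    using B(2)[OF that, of "complex_of_real r"] Q(1) that unfolding map_on_def
    by (auto simp flip: op_scaleC_of_real)
  have zero: "0 \<in> B" "Q 0 = 0"
    using scaleR[OF uB, of 0] by auto
  have unorm: "norm (u x) \<le> norm x" for x
  proof -
    have "(norm (u x))\<^sup>2 = Re (cinner x (u x))"
      using u(3)[of x x] by (simp add: cinner_norm)
    also have "\<dots> \<le> norm x * norm (u x)"
      using complex_Re_le_cmod cinner_le_norm order_trans by blast
    finally show ?thesis by (cases "u x = 0") (auto simp: power2_eq_square)
  qed
  have "cinner x (m *\<^sub>R u x) = complex_of_real (m * (norm (u x))\<^sup>2)" for x m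
    using u(3)[of x x] by (simp add: cinner_scaleR_right cinner_norm)
  then have diag: "re_form k (mat_diag (m *\<^sub>R u)) v = m * (\<Sum>i<k. (norm (u (v i)))\<^sup>2)" for k m v
    by (simp add: re_form_diag blinfun.scaleR_left sum_distrib_left)
  have bound: "vec_norm n (mat_apply n (amplification Q X) w) \<le> m * vec_norm n w"
    if m: "mat_norm n X \<le> m" "0 < m" for m
  proof -
    define Y where "Y = corner_matrix n (m *\<^sub>R u) X"
    have Y: "Y \<in> matrices (n + n) B"
      using X uB scaleR(1) zero(1) by (auto simp: Y_def corner_matrix_def matrices_def)
    have "0 \<le> re_form (n + n) Y v" for v
    proof -
      define a b where "a = (\<lambda>i. u (v i))" and "b = (\<lambda>i. u (v (n + i)))"
      have "cinner (v i) (X i j (v (n + j))) = cinner (a i) (X i j (b j))" if "i < n" "j < n" for i j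
        using X that u(3)[of "v i" "X i j (v (n + j))"] unit by (simp add: a_def b_def matrices_def)
      then have "vec_cinner n v (mat_apply n X (\<lambda>j. v (n + j))) = - vec_cinner n (\<lambda>i. (-1) *\<^sub>R a i) (mat_apply n X b)"
        unfolding vec_cinner_def mat_apply_def cinner_sum_right sum_negf[symmetric] cinner_scaleR_left
        by (intro sum.cong refl) auto
      then have "- Re (vec_cinner n v (mat_apply n X (\<lambda>j. v (n + j)))) \<le> vec_norm n a * vec_norm n (mat_apply n X b)"
        using vec_cinner_le[of n "\<lambda>i. (-1) *\<^sub>R a i" "mat_apply n X b"] by (simp only: vec_norm_scaleR) simp
      also have "\<dots> \<le> vec_norm n a * (m * vec_norm n b)"
        using mat_norm_apply[of n X b] mult_right_mono[OF m(1), of "vec_norm n b"]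
        by (intro mult_left_mono) auto
      finally have "- Re (vec_cinner n v (mat_apply n X (\<lambda>j. v (n + j)))) \<le>
        vec_norm n a * (m * vec_norm n b)" .
      moreover have "2 * (vec_norm n a * (m * vec_norm n b)) = m * (2 * vec_norm n a * vec_norm n b)"
        by (simp only: mult_ac)
      moreover have "\<dots> \<le> m * ((vec_norm n a)\<^sup>2 + (vec_norm n b)\<^sup>2)"
        by (rule mult_left_mono[OF sum_squares_bound]) (use m(2) in simp)
      moreover have "\<dots> = re_form (n + n) (mat_diag (m *\<^sub>R u)) v"
        unfolding diag vec_norm_sq a_def b_def sum_lessThan_add ..
      ultimately show ?thesis
        unfolding Y_def re_form_corner by linarith
    qed
    then have "Y \<in> real_positive (n + n) B"
      using Y by (simp add: real_positive_iff[OF B(1)])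
    then have "amplification Q Y \<in> real_positive (n + n) B"
      using Q(2) unfolding real_completely_positive_def by blast
    then have "0 \<le> re_form (n + n) (amplification Q Y) v" for v
      by (simp add: real_positive_iff[OF B(1)])
    moreover have "re_form (n + n) (amplification Q Y) v =
        re_form (n + n) (corner_matrix n (m *\<^sub>R u) (amplification Q X)) v" for v
      using X scaleR zero uB u(2)
      by (intro re_form_cong) (auto simp: amplification_def Y_def corner_matrix_def matrices_def)
    ultimately have pos: "0 \<le> re_form (n + n) (corner_matrix n (m *\<^sub>R u) (amplification Q X)) v" for v
      by simp
    define y where "y = mat_apply n (amplification Q X) w"
    define v where "v i = (if i < n then (-1) *\<^sub>R y i else m *\<^sub>R w (i - n))" for i
    have "vec_cinner n v (mat_apply n (amplification Q X) (\<lambda>j. v (n + j))) = - complex_of_real (m * (vec_norm n y)\<^sup>2)"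
    proof -
      have "mat_apply n (amplification Q X) (\<lambda>j. v (n + j)) = (\<lambda>i. m *\<^sub>R y i)"
        unfolding y_def mat_apply_scaleR[symmetric] by (simp add: v_def)
      then have "vec_cinner n v (mat_apply n (amplification Q X) (\<lambda>j. v (n + j))) =
          (\<Sum>i<n. - complex_of_real (m * (norm (y i))\<^sup>2))"
        unfolding vec_cinner_def by (intro sum.cong) (auto simp: v_def cinner_scaleR_right cinner_minus_left cinner_norm)
      then show ?thesis
        by (simp add: vec_norm_sq sum_negf sum_distrib_left)
    qed
    moreover have "re_form (n + n) (mat_diag (m *\<^sub>R u)) v \<le> m * ((vec_norm n y)\<^sup>2 + m\<^sup>2 * (vec_norm n w)\<^sup>2)"
    proof -
      have "(\<Sum>i<n. (norm (u (v i)))\<^sup>2) \<le> (\<Sum>i<n. (norm (y i))\<^sup>2)"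
        using unorm by (intro sum_mono power_mono) (auto simp: v_def blinfun.minus_right)
      moreover have "(\<Sum>i<n. (norm (u (v (n + i))))\<^sup>2) \<le> (\<Sum>i<n. m\<^sup>2 * (norm (w i))\<^sup>2)"
        using unorm[of "m *\<^sub>R w _"] m(2) unfolding power_mult_distrib[symmetric]
        by (intro sum_mono power_mono) (auto simp: v_def)
      ultimately show ?thesis
        unfolding diag sum_lessThan_add vec_norm_sq sum_distrib_left[symmetric]
        using m(2) by (intro mult_left_mono) auto
    qed
    ultimately have "2 * (m * (vec_norm n y)\<^sup>2) \<le> m * ((vec_norm n y)\<^sup>2 + m\<^sup>2 * (vec_norm n w)\<^sup>2)"
      using pos[of v] unfolding re_form_corner by simp
    then have "(vec_norm n y)\<^sup>2 \<le> (m * vec_norm n w)\<^sup>2"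
      using m(2) by (simp add: power_mult_distrib distrib_left)
    then show ?thesis
      unfolding y_def by (rule power2_le_imp_le) (use m(2) in simp)
  qed
  have "vec_norm n (mat_apply n (amplification Q X) w) \<le> mat_norm n X * vec_norm n w + \<epsilon>" if "0 < \<epsilon>" for \<epsilon>
  proof -
    define \<delta> where "\<delta> = \<epsilon> / (vec_norm n w + 1)"
    have r: "0 < vec_norm n w + 1" using vec_norm_nonneg[of n w] by linarith
    then have \<delta>: "0 < \<delta>" using that by (simp add: \<delta>_def)
    have "\<delta> * vec_norm n w \<le> \<delta> * (vec_norm n w + 1)" using \<delta> by simp
    also have "\<dots> = \<epsilon>" using r by (simp add: \<delta>_def)
    finally show ?thesis
      using bound[of "mat_norm n X + \<delta>"] \<delta> mat_norm_nonneg[of n X] by (simp add: distrib_right)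
  qed
  then show "vec_norm n (mat_apply n (amplification Q X) w) \<le> mat_norm n X * vec_norm n w"
    by (rule field_le_epsilon)
qed

section \<open>Scalar matrices with positive real part\<close>

abbreviation scalar_form :: "nat \<Rightarrow> (nat \<Rightarrow> nat \<Rightarrow> complex) \<Rightarrow> (nat \<Rightarrow> complex) \<Rightarrow> real"
  where "scalar_form n c \<mu> \<equiv> Re (\<Sum>i<n. \<Sum>j<n. cnj (\<mu> i) * c i j * \<mu> j)"

definition herm_part :: "(nat \<Rightarrow> nat \<Rightarrow> complex) \<Rightarrow> nat \<Rightarrow> nat \<Rightarrow> complex"
  where "herm_part c i j = (c i j + cnj (c j i)) / 2"

definition skew_part :: "(nat \<Rightarrow> nat \<Rightarrow> complex) \<Rightarrow> nat \<Rightarrow> nat \<Rightarrow> complex"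
  where "skew_part c i j = (c i j - cnj (c j i)) / 2"

lemma skew_part_swap: "skew_part c j i = - cnj (skew_part c i j)"
  by (simp add: skew_part_def field_simps)

lemma herm_skew: "c i j = herm_part c i j + skew_part c i j"
  by (simp add: herm_part_def skew_part_def field_simps)

lemma re_form_herm_skew:
  "re_form n (\<lambda>i j. op_scaleC (c i j) D) v =
    re_form n (\<lambda>i j. op_scaleC (herm_part c i j) D) v + re_form n (\<lambda>i j. op_scaleC (skew_part c i j) D) v"
  by (subst herm_skew) (simp only: op_scaleC_add_left re_form_add)

lemma scalar_form_eq_re_form: "scalar_form n c \<mu> = re_form n (\<lambda>i j. op_scaleC (c i j) id_blinfun) \<mu>"
  unfolding re_form_def Re_sum
  by (intro sum.cong refl) (simp add: cinner_scaleC_right cinner_complex_def scaleC_complex_def mult_ac del: times_complex.sel)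

lemma psd_herm_part:
  assumes "\<And>\<mu>. 0 \<le> scalar_form n c \<mu>"
  shows "psd n (herm_part c)"
  unfolding psd_def
proof (intro conjI allI impI)
  show "herm_part c j i = cnj (herm_part c i j)" for i j
    by (simp add: herm_part_def add.commute)
  have "re_form n (\<lambda>i j. op_scaleC (skew_part c i j) id_blinfun) \<mu> = 0" for \<mu> :: "nat \<Rightarrow> complex"
    by (rule skew_tensor_symmetric) (simp_all add: skew_part_swap[symmetric])
  then show "0 \<le> scalar_form n (herm_part c) \<mu>" for \<mu>
    using assms[of \<mu>] unfolding scalar_form_eq_re_form re_form_herm_skew[of n c] by simp
qed

section \<open>The nonunital case\<close>

text \<open>For small \<open>s > 0\<close> the operator \<open>1 - s b\<close> has norm below 1, and \<open>1 - (1 - s b)^k\<close> lies in the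
  algebra and converges to \<open>1\<close>.\<close>

lemma strictly_accretive_imp_identity:
  assumes A: "operator_algebra A" and b: "b \<in> A" and \<epsilon>: "0 < \<epsilon>"
    and acc: "\<And>x. \<epsilon> * (norm x)\<^sup>2 \<le> Re (cinner x (b x))"
  shows "id_blinfun \<in> A"
proof -
  note AD = operator_algebraD[OF A]
  \<comment> \<open>The value of \<open>s\<close> minimizes \<open>1 - 2 s \<epsilon> + s\<^sup>2 K\<^sup>2\<close>; including \<open>\<epsilon>\<close> in \<open>K\<close> keeps the minimum
    nonnegative.\<close>
  define K where "K = norm b + \<epsilon>"
  have K: "norm b \<le> K" "\<epsilon> \<le> K" "0 < K" using \<epsilon> by (auto simp: K_def add_nonneg_pos)
  define s where "s = \<epsilon> / K\<^sup>2"
  define q where "q = sqrt (1 - \<epsilon>\<^sup>2 / K\<^sup>2)"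
  have q: "q\<^sup>2 = 1 - \<epsilon>\<^sup>2 / K\<^sup>2" "0 \<le> q" "q < 1"
    using K \<epsilon> power_mono[OF K(2), of 2] by (auto simp: q_def)
  define T where "T = id_blinfun - s *\<^sub>R b"
  have "norm T \<le> q"
  proof (rule norm_blinfun_bound[OF q(2)])
    fix x
    have "(norm (T x))\<^sup>2 = (norm x)\<^sup>2 - 2 * (s * Re (cinner x (b x))) + s\<^sup>2 * (norm (b x))\<^sup>2"
      by (simp add: T_def blinfun.diff_left blinfun.scaleR_left norm_diff_sq cinner_scaleR_right power_mult_distrib)
    also have "\<dots> \<le> (norm x)\<^sup>2 - 2 * (s * (\<epsilon> * (norm x)\<^sup>2)) + s\<^sup>2 * (K * norm x)\<^sup>2"
      using acc[of x] norm_blinfun_le[OF K(1), of x] \<epsilon> K(3)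
      by (intro add_mono diff_mono mult_left_mono power_mono) (auto simp: s_def)
    also have "\<dots> = q\<^sup>2 * (norm x)\<^sup>2"
      using K(3) unfolding q(1) s_def by (simp add: field_simps power2_eq_square)
    finally have "(norm (T x))\<^sup>2 \<le> (q * norm x)\<^sup>2" by (simp add: power_mult_distrib)
    then show "norm (T x) \<le> q * norm x"
      by (rule power2_le_imp_le) (use q in simp)
  qed
  define W where "W k = ((\<lambda>S. S o\<^sub>L T) ^^ k) id_blinfun" for k
  have W: "W 0 = id_blinfun" "W (Suc k) = W k o\<^sub>L T" for k
    by (simp_all add: W_def)
  have "id_blinfun - W k \<in> A \<and> norm (W k) \<le> q ^ k" for k
  proof (induction k)
    case 0
    show ?case using AD(3) by (simp add: W norm_blinfun_id_le)
  next
    case (Suc k)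
    have "id_blinfun - W (Suc k) = (id_blinfun - W k) + s *\<^sub>R (b - ((id_blinfun - W k) o\<^sub>L b))"
      by (rule blinfun_eqI) (simp add: W T_def blinfun.bilinear_simps)
    also have "\<dots> \<in> A"
      using Suc b by (blast intro: AD)
    finally have "id_blinfun - W (Suc k) \<in> A" .
    moreover have "norm (W k o\<^sub>L T) \<le> q ^ k * q"
      using Suc \<open>norm T \<le> q\<close> q(2) by (intro order_trans[OF norm_blinfun_compose] mult_mono) auto
    ultimately show ?case by (simp add: W mult.commute)
  qed
  note IH = this
  have "(\<lambda>k. q ^ k) \<longlonglongrightarrow> 0" using q by (intro LIMSEQ_power_zero) auto
  then have "W \<longlonglongrightarrow> 0"
    by (rule Lim_null_comparison[rotated]) (use IH in auto)
  then have "(\<lambda>k. id_blinfun - W k) \<longlonglongrightarrow> id_blinfun - 0"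
    by (intro tendsto_intros)
  then show ?thesis
    using closed_sequentially[OF AD(2), of "\<lambda>k. id_blinfun - W k"] IH by simp
qed

lemma identity_imp_unital: "id_blinfun \<in> A \<Longrightarrow> unital_algebra A"
  unfolding unital_algebra_def is_identity_def by (auto intro!: exI[of _ id_blinfun] blinfun_eqI)

text \<open>Without a unit, the scalar part of an accretive matrix over the unitization is accretive.
  Otherwise compressing by a scalar vector gives a strictly accretive element of \<open>A\<close>.\<close>

lemma scalar_part_accretive:
  assumes A: "operator_algebra A" "\<not> unital_algebra A" and a: "a \<in> matrices n A"
    and pos: "\<And>v. 0 \<le> re_form n (\<lambda>i j. a i j + op_scaleC (c i j) id_blinfun) v"
  shows "0 \<le> scalar_form n c \<mu>"
proof (rule ccontr)
  assume neg: "\<not> 0 \<le> scalar_form n c \<mu>"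
  note AD = operator_algebraD[OF A(1)]
  define b where "b = (\<Sum>i<n. \<Sum>j<n. op_scaleC (cnj (\<mu> i) * \<mu> j) (a i j))"
  have "b \<in> A"
    unfolding b_def using a by (intro AD) (auto simp: matrices_def)
  moreover have "- scalar_form n c \<mu> * (norm x)\<^sup>2 \<le> Re (cinner x (b x))" for x
  proof -
    have lin: "a i j (k *\<^sub>C x) = k *\<^sub>C a i j x" if "i < n" "j < n" for i j k
    proof -
      have "a i j \<in> bounded_operators" using a AD(1) that by (auto simp: matrices_def)
      then show ?thesis by (simp add: bounded_operators_def)
    qed
    have "0 \<le> re_form n (\<lambda>i j. a i j + op_scaleC (c i j) id_blinfun) (\<lambda>i. \<mu> i *\<^sub>C x)"
      by (rule pos)
    also have "\<dots> = re_form n a (\<lambda>i. \<mu> i *\<^sub>C x) + re_form n (\<lambda>i j. op_scaleC (c i j) id_blinfun) (\<lambda>i. \<mu> i *\<^sub>C x)"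
      by (rule re_form_add)
    also have "re_form n a (\<lambda>i. \<mu> i *\<^sub>C x) = Re (cinner x (b x))"
      unfolding b_def blinfun.sum_left cinner_sum_right Re_sum re_form_def
      by (intro sum.cong refl) (simp add: lin cinner_scaleC_left cinner_scaleC_right mult_ac del: times_complex.sel)
    also have "re_form n (\<lambda>i j. op_scaleC (c i j) id_blinfun) (\<lambda>i. \<mu> i *\<^sub>C x) =
        Re ((\<Sum>i<n. \<Sum>j<n. cnj (\<mu> i) * c i j * \<mu> j) * complex_of_real ((norm x)\<^sup>2))"
      unfolding re_form_def sum_distrib_right Re_sum
      by (intro sum.cong refl)
        (simp only: op_scaleC_apply id_blinfun.rep_eq id_apply cinner_scaleC_left cinner_scaleC_right cinner_norm mult_ac)
    also have "\<dots> = scalar_form n c \<mu> * (norm x)\<^sup>2"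
      by (simp del: Re_sum Im_sum of_real_power)
    finally show ?thesis by linarith
  qed
  moreover have "0 < - scalar_form n c \<mu>" using neg by linarith
  ultimately have "id_blinfun \<in> A"
    using strictly_accretive_imp_identity[OF A(1)] by blast
  then show False using A(2) identity_imp_unital by blast
qed

lemma positive_map_unitization:
  assumes A: "operator_algebra A" "approximately_unital A" "\<not> unital_algebra A"
    and P: "map_on A P" "real_completely_positive A P" "\<And>a. a \<in> A \<Longrightarrow> norm (P a) \<le> norm a"
    and a: "a \<in> matrices n A"
    and pos: "\<And>v. 0 \<le> re_form n (\<lambda>i j. a i j + op_scaleC (c i j) id_blinfun) v"
  shows "0 \<le> re_form n (\<lambda>i j. P (a i j) + op_scaleC (c i j) id_blinfun) v"
proof -
  have "re_form n (\<lambda>i j. op_scaleC (skew_part c i j) id_blinfun) v = 0" for v :: "nat \<Rightarrow> 'a"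
    by (rule skew_tensor_symmetric) (simp_all add: skew_part_swap[symmetric])
  then have herm: "re_form n (\<lambda>i j. b i j + op_scaleC (c i j) id_blinfun) v =
      re_form n (\<lambda>i j. b i j + op_scaleC (herm_part c i j) id_blinfun) v" for b and v :: "nat \<Rightarrow> 'a"
    unfolding re_form_add re_form_herm_skew[of n c] by simp
  show ?thesis
    unfolding herm
  proof (rule positive_map_psd_extension[OF A(1,2) P a])
    show "psd n (herm_part c)"
      by (rule psd_herm_part) (rule scalar_part_accretive[OF A(1,3) a pos])
    show "0 \<le> re_form n (\<lambda>i j. a i j + op_scaleC (herm_part c i j) id_blinfun) v" for v
      using pos[of v] unfolding herm .
  qed
qed

lemma unitization_bounded: "A \<subseteq> bounded_operators \<Longrightarrow> unitization A \<subseteq> bounded_operators"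
  by (auto simp: unitization_def bounded_operators_def subset_iff blinfun.add_left scaleC_add_right
      scaleC_scaleC mult.commute)

lemma unitization_extension:
  assumes A: "operator_algebra A" "approximately_unital A" "\<not> unital_algebra A"
    and P: "map_on A P" "real_completely_positive A P" "completely_contractive A P"
  shows "\<exists>Q. map_on (unitization A) Q \<and>
        (\<forall>a\<in>A. Q a = P a) \<and>
        unital_on (unitization A) Q \<and>
        real_completely_positive (unitization A) Q \<and>
        completely_contractive (unitization A) Q \<and>
        (projection_on A P \<longrightarrow> projection_on (unitization A) Q)"
proof -
  note AD = operator_algebraD[OF A(1)]
  have P_mem: "P a \<in> A" if "a \<in> A" for a using P(1) that by (auto simp: map_on_def)
  have P_add: "P (a + b) = P a + P b" if "a \<in> A" "b \<in> A" for a b using P(1) that by (auto simp: map_on_def)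
  have P_scale: "P (op_scaleC c a) = op_scaleC c (P a)" if "a \<in> A" for a c using P(1) that by (auto simp: map_on_def)
  have P0: "P 0 = 0" using P_scale[OF AD(3), of 0] by simp
  define U where "U a c = a + op_scaleC c id_blinfun" for a :: "'a \<Rightarrow>\<^sub>L 'a" and c
  \<comment> \<open>Without a unit \<open>A\<close> does not contain the identity, so the scalar part is determined.\<close>
  have coeff: "c = d" if "U a c - op_scaleC d id_blinfun \<in> A" "a \<in> A" for a c d
  proof (rule ccontr)
    assume "c \<noteq> d"
    have "(U a c - op_scaleC d id_blinfun) - a = op_scaleC (c - d) id_blinfun"
      using op_scaleC_add_left[of "c - d" d id_blinfun] by (simp add: U_def diff_eq_eq)
    then have "op_scaleC (c - d) id_blinfun \<in> A" using AD(7)[OF that] by simp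
    then have "op_scaleC (1 / (c - d)) (op_scaleC (c - d) id_blinfun) \<in> A" by (rule AD(5))
    then have "id_blinfun \<in> A"
      using \<open>c \<noteq> d\<close> by (simp add: op_scaleC_scaleC)
    then show False
      using A(3) identity_imp_unital by blast
  qed
  define Q where "Q T = (let c = (THE c. T - op_scaleC c id_blinfun \<in> A) in U (P (T - op_scaleC c id_blinfun)) c)" for T
  have Q: "Q (U a c) = U (P a) c" if "a \<in> A" for a c
  proof -
    have "(THE d. U a c - op_scaleC d id_blinfun \<in> A) = c"
      by (rule the_equality) (use that coeff[OF _ that] in \<open>auto simp: U_def\<close>)
    then show ?thesis by (simp add: Q_def U_def)
  qed
  have U_mem: "U a c \<in> unitization A" if "a \<in> A" for a c
    using that by (auto simp: U_def unitization_def)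
  have U_ex: "\<exists>a c. a \<in> A \<and> T = U a c" if "T \<in> unitization A" for T
    using that by (auto simp: U_def unitization_def)
  have U_add: "U a c + U b d = U (a + b) (c + d)" and U_scale: "op_scaleC k (U a c) = U (op_scaleC k a) (k * c)"
    for a b c d k by (simp_all add: U_def op_scaleC_add_left op_scaleC_add_right op_scaleC_scaleC)
  have U0: "U a 0 = a" for a by (simp add: U_def)
  have map: "map_on (unitization A) Q"
    unfolding map_on_def
  proof (intro conjI ballI allI)
    fix S T k assume "S \<in> unitization A" "T \<in> unitization A"
    then obtain a c b d where st: "a \<in> A" "S = U a c" "b \<in> A" "T = U b d" using U_ex by metis
    show "Q S \<in> unitization A" "Q (S + T) = Q S + Q T" "Q (op_scaleC k S) = op_scaleC k (Q S)"
      using st by (simp_all add: Q U_add U_scale U_mem P_mem AD(4,5) P_add P_scale)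
  qed
  have unit: "is_identity (unitization A) id_blinfun" "Q id_blinfun = id_blinfun"
    using U_mem[OF AD(3), of 1] Q[OF AD(3), of 1] by (auto simp: is_identity_def U_def P0 intro!: blinfun_eqI)
  have rcp: "real_completely_positive (unitization A) Q"
    unfolding real_completely_positive_def
  proof (intro allI subsetI, elim imageE)
    fix n X Y assume Y: "Y = amplification Q X" and X: "X \<in> real_positive n (unitization A)"
    note iff = real_positive_iff[OF unitization_bounded[OF AD(1)]]
    have XU: "X i j \<in> unitization A" if "i < n" "j < n" for i j
      using X that by (auto simp: iff matrices_def)
    then have "\<forall>i j. \<exists>a c. i < n \<longrightarrow> j < n \<longrightarrow> a \<in> A \<and> X i j = U a c"
      using U_ex by blast
    then obtain a c where ac: "\<And>i j. i < n \<Longrightarrow> j < n \<Longrightarrow> a i j \<in> A \<and> X i j = U (a i j) (c i j)"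
      by metis
    have "0 \<le> re_form n (\<lambda>i j. a i j + op_scaleC (c i j) id_blinfun) v" for v
    proof -
      have "re_form n X v = re_form n (\<lambda>i j. a i j + op_scaleC (c i j) id_blinfun) v"
        by (rule re_form_cong) (simp add: ac U_def)
      moreover have "0 \<le> re_form n X v" using X by (simp add: iff)
      ultimately show ?thesis by simp
    qed
    moreover have "a \<in> matrices n A" using ac by (simp add: matrices_def)
    ultimately have "0 \<le> re_form n (\<lambda>i j. P (a i j) + op_scaleC (c i j) id_blinfun) v" for v
      using positive_map_unitization[OF A P(1,2) completely_contractive_norm[OF P(3)]] by blast
    moreover have "re_form n Y v = re_form n (\<lambda>i j. P (a i j) + op_scaleC (c i j) id_blinfun) v" for v
      by (rule re_form_cong) (simp add: Y amplification_def ac Q, simp add: U_def)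
    moreover have "Y \<in> matrices n (unitization A)"
      using map XU by (auto simp: Y matrices_def amplification_def map_on_def)
    ultimately show "Y \<in> real_positive n (unitization A)"
      by (simp add: iff)
  qed
  have scale: "op_scaleC k T \<in> unitization A" if "T \<in> unitization A" for k T
    using U_ex[OF that] U_scale U_mem AD(5) by metis
  have "completely_contractive (unitization A) Q"
    by (rule unital_real_positive_contractive[OF unitization_bounded[OF AD(1)] scale map rcp unit]) auto
  moreover have "\<forall>a\<in>A. Q a = P a" using Q[of _ 0] by (simp add: U0)
  moreover have "projection_on (unitization A) Q" if "projection_on A P"
    unfolding projection_on_def
  proof (intro conjI ballI map)
    fix T assume "T \<in> unitization A"
    then obtain a c where "a \<in> A" "T = U a c" using U_ex by blast
    then show "Q (Q T) = Q T" using that by (simp add: Q P_mem projection_on_def)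
  qed
  ultimately show ?thesis
    using map rcp unit by (auto simp: unital_on_def)
qed

section \<open>The unital case\<close>

lemma op_dsum_apply [simp]: "op_dsum a c x = (a (fst x), c * snd x)"
  by (simp add: op_dsum.rep_eq case_prod_unfold)

lemma op_dsum_add: "op_dsum a c + op_dsum b d = op_dsum (a + b) (c + d)"
  by (rule blinfun_eqI) (simp add: blinfun.add_left distrib_right)

lemma op_dsum_scale: "op_scaleC k (op_dsum a c) = op_dsum (op_scaleC k a) (k * c)"
  by (rule blinfun_eqI) (simp add: scaleC_prod_def scaleC_complex_def mult.assoc)

lemma op_dsum_compose: "op_dsum a c o\<^sub>L op_dsum b d = op_dsum (a o\<^sub>L b) (c * d)"
  by (rule blinfun_eqI) simp

lemma op_dsum_inject: "op_dsum a c = op_dsum b d \<longleftrightarrow> a = b \<and> c = d"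
proof
  assume eq: "op_dsum a c = op_dsum b d"
  have "(a x, c) = (b x, d)" for x
    using arg_cong[OF eq, of "\<lambda>T. blinfun_apply T (x, 1)"] by simp
  then show "a = b \<and> c = d" by (auto intro: blinfun_eqI)
qed simp

lemma dsum_bounded: "A \<subseteq> bounded_operators \<Longrightarrow> dsum_complex A \<subseteq> bounded_operators"
  by (auto simp: dsum_complex_def bounded_operators_def subset_iff scaleC_prod_def scaleC_complex_def)

lemma re_form_op_dsum:
  "re_form n (\<lambda>i j. op_dsum (a i j) (c i j)) v =
    re_form n a (\<lambda>i. fst (v i)) + scalar_form n c (\<lambda>i. snd (v i))"
  unfolding re_form_def Re_sum sum.distrib[symmetric]
  by (intro sum.cong refl) (simp add: cinner_prod_def cinner_complex_def mult.assoc del: times_complex.sel)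

lemma unit_norm_le_one:
  assumes "approximately_unital A" "is_identity A e"
  shows "norm e \<le> 1"
proof (rule field_le_epsilon)
  fix \<epsilon> :: real assume "0 < \<epsilon>"
  moreover have "{e} \<subseteq> A" using assms(2) by (simp add: is_identity_def)
  ultimately obtain f where f: "f \<in> A" "norm f \<le> 1" "norm ((f o\<^sub>L e) - e) \<le> \<epsilon>"
    using contractive_almost_unit[OF assms(1), of "{e}" \<epsilon>] by auto
  then have "norm (f - e) \<le> \<epsilon>" using assms(2) by (simp add: is_identity_def)
  then show "norm e \<le> 1 + \<epsilon>"
    using f(2) norm_triangle_ineq2[of e f] by (simp add: norm_minus_commute)
qed

text \<open>A contractive idempotent is an orthogonal projection.\<close>

lemma contractive_idempotent_symmetric:
  assumes e: "e \<in> bounded_operators" "norm e \<le> 1" "e o\<^sub>L e = e"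
  shows "cinner x (e y) = cinner (e x) (e y)"
proof -
  have ee: "e (e y) = e y" using e(3) by (metis blinfun_apply_blinfun_compose)
  have "(norm (op_adjoint e (e y) - e y))\<^sup>2 \<le> 2 * norm (e y) * norm (e (e y) - e y)"
    by (rule adjoint_almost_fixes)
      (use op_adjoint_works[OF e(1)] norm_op_adjoint_apply[OF e(1,2), of "e y"] in auto)
  then have "op_adjoint e (e y) = e y" by (simp add: ee)
  then have "cinner (e y) x = cinner (e y) (e x)"
    using op_adjoint_works[OF e(1), of "e y" x] by simp
  then show ?thesis by (metis cinner_commute)
qed

text \<open>The hermitian part of \<open>c\<close> is handled by Schur's theorem, since
  \<open>Re \<langle>x, P e x\<rangle> = Re \<langle>e x, P e (e x)\<rangle> \<le> \<parallel>e x\<parallel>\<^sup>2 = \<langle>x, e x\<rangle>\<close>. The skew part \<open>K\<close> contributes nothing: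
  both \<open>K \<otimes> e\<close> and \<open>- K \<otimes> e\<close> are real positive, hence so are their images, so the real part of
  \<open>K \<otimes> P e\<close> vanishes.\<close>

lemma positive_map_complement:
  assumes A: "operator_algebra A"
    and P: "map_on A P" "real_completely_positive A P" "\<And>a. a \<in> A \<Longrightarrow> norm (P a) \<le> norm a"
    and e: "is_identity A e" "norm e \<le> 1"
    and c: "\<And>\<mu>. 0 \<le> scalar_form n c \<mu>"
  shows "0 \<le> re_form n (\<lambda>i j. op_scaleC (c i j) (e - P e)) v"
proof -
  note AD = operator_algebraD[OF A]
  have eA: "e \<in> A" and PeA: "P e \<in> A"
    using e(1) P(1) by (auto simp: is_identity_def map_on_def)
  have unit: "e (a x) = a x" "a (e x) = a x" if "a \<in> A" for a x
    using e(1) that unfolding is_identity_def by (metis blinfun_apply_blinfun_compose)+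
  have e_sym: "cinner x (e y) = cinner (e x) (e y)" for x y
    using contractive_idempotent_symmetric[of e] eA AD(1) e by (auto simp: is_identity_def)
  have e_swap: "cinner x (e y) = cinner (e x) y" for x y
    using e_sym[of x y] e_sym[of y x] cinner_commute by metis
  have accretive: "0 \<le> Re (cinner x ((e - P e) x))" for x
  proof -
    have "cinner x (P e x) = cinner (e x) (P e (e x))"
      using e_sym[of x "P e x"] unit[OF PeA] by simp
    moreover have "norm (P e (e x)) \<le> norm (e x)"
      by (rule norm_contraction_le) (use P(3)[OF eA] e(2) in linarith)
    then have "Re (cinner (e x) (P e (e x))) \<le> norm (e x) * norm (e x)"
      using complex_Re_le_cmod[of "cinner (e x) (P e (e x))"] cinner_le_norm[of "e x" "P e (e x)"]
        mult_left_mono[of "norm (P e (e x))" "norm (e x)" "norm (e x)"] by simp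
    moreover have "Re (cinner x (e x)) = norm (e x) * norm (e x)"
      unfolding e_sym[of x x] by (simp add: cinner_norm power2_eq_square)
    ultimately show ?thesis
      by (simp add: blinfun.diff_left cinner_diff_right)
  qed
  have skew_nonneg: "0 \<le> re_form n (\<lambda>i j. op_scaleC (K i j) (P e)) v"
    if K: "\<And>i j. K j i = - cnj (K i j)" for K
  proof -
    have "(\<lambda>i j. op_scaleC (K i j) e) \<in> real_positive n A"
      using eA AD(5) skew_tensor_symmetric[of e n K, OF e_swap K]
      by (simp add: real_positive_iff[OF AD(1)] matrices_def)
    then have "amplification P (\<lambda>i j. op_scaleC (K i j) e) \<in> real_positive n A"
      using P(2) unfolding real_completely_positive_def by blast
    then have "0 \<le> re_form n (amplification P (\<lambda>i j. op_scaleC (K i j) e)) v"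
      by (simp add: real_positive_iff[OF AD(1)])
    moreover have "amplification P (\<lambda>i j. op_scaleC (K i j) e) = (\<lambda>i j. op_scaleC (K i j) (P e))"
      using P(1) eA by (auto simp: amplification_def map_on_def fun_eq_iff)
    ultimately show ?thesis by simp
  qed
  have "re_form n (\<lambda>i j. op_scaleC (- skew_part c i j) (P e)) v =
      - re_form n (\<lambda>i j. op_scaleC (skew_part c i j) (P e)) v"
    by (simp add: re_form_def cinner_scaleC_right sum_negf[symmetric])
  moreover have "0 \<le> re_form n (\<lambda>i j. op_scaleC (- skew_part c i j) (P e)) v"
    by (rule skew_nonneg) (subst skew_part_swap, simp)
  moreover have "0 \<le> re_form n (\<lambda>i j. op_scaleC (skew_part c i j) (P e)) v"
    by (rule skew_nonneg) (rule skew_part_swap)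
  ultimately have "re_form n (\<lambda>i j. op_scaleC (skew_part c i j) (P e)) v = 0"
    by linarith
  moreover have "re_form n (\<lambda>i j. op_scaleC (skew_part c i j) e) v = 0"
    by (rule skew_tensor_symmetric[OF e_swap skew_part_swap])
  moreover have "re_form n (\<lambda>i j. op_scaleC (skew_part c i j) (e - P e)) v =
      re_form n (\<lambda>i j. op_scaleC (skew_part c i j) e) v - re_form n (\<lambda>i j. op_scaleC (skew_part c i j) (P e)) v"
    by (simp add: re_form_def blinfun.diff_left cinner_diff_right cinner_scaleC_right
        right_diff_distrib sum_subtractf)
  moreover have "0 \<le> re_form n (\<lambda>i j. op_scaleC (herm_part c i j) (e - P e)) v"
    using AD(1) AD(7)[OF eA PeA] by (intro psd_tensor_accretive accretive psd_herm_part c) auto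
  ultimately show ?thesis
    unfolding re_form_herm_skew[of n c] by simp
qed

lemma dsum_extension:
  assumes A: "operator_algebra A" "approximately_unital A" "is_identity A e"
    and P: "map_on A P" "real_completely_positive A P" "completely_contractive A P"
  shows "\<exists>Q. map_on (dsum_complex A) Q \<and>
        (\<forall>a\<in>A. Q (op_dsum a 0) = op_dsum (P a) 0) \<and>
        unital_on (dsum_complex A) Q \<and>
        real_completely_positive (dsum_complex A) Q \<and>
        completely_contractive (dsum_complex A) Q \<and>
        (projection_on A P \<longrightarrow> projection_on (dsum_complex A) Q)"
proof -
  note AD = operator_algebraD[OF A(1)]
  have P_mem: "P a \<in> A" if "a \<in> A" for a using P(1) that by (auto simp: map_on_def)
  have P_add: "P (a + b) = P a + P b" if "a \<in> A" "b \<in> A" for a b using P(1) that by (auto simp: map_on_def)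
  have P_scale: "P (op_scaleC c a) = op_scaleC c (P a)" if "a \<in> A" for a c using P(1) that by (auto simp: map_on_def)
  have P0: "P 0 = 0" using P_scale[OF AD(3), of 0] by simp
  have eA: "e \<in> A" and ee: "e o\<^sub>L e = e" and e_norm: "norm e \<le> 1"
    using A(3) unit_norm_le_one[OF A(2,3)] by (auto simp: is_identity_def)
  define R where "R a c = P a + op_scaleC c (e - P e)" for a c
  have R_mem: "R a c \<in> A" if "a \<in> A" for a c
    unfolding R_def using that eA P_mem by (blast intro: AD)
  define Q where "Q T = (let p = (THE p. T = op_dsum (fst p) (snd p)) in op_dsum (R (fst p) (snd p)) (snd p))" for T
  have Q: "Q (op_dsum a c) = op_dsum (R a c) c" for a c
  proof -
    have "(THE p. op_dsum a c = op_dsum (fst p) (snd p)) = (a, c)"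
      by (rule the_equality) (auto simp: op_dsum_inject)
    then show ?thesis by (simp add: Q_def)
  qed
  have mem: "op_dsum a c \<in> dsum_complex A" if "a \<in> A" for a c
    using that by (auto simp: dsum_complex_def)
  have ex: "\<exists>a c. a \<in> A \<and> T = op_dsum a c" if "T \<in> dsum_complex A" for T
    using that by (auto simp: dsum_complex_def)
  have map: "map_on (dsum_complex A) Q"
    unfolding map_on_def
  proof (intro conjI ballI allI)
    fix S T k assume "S \<in> dsum_complex A" "T \<in> dsum_complex A"
    then obtain a c b d where st: "a \<in> A" "S = op_dsum a c" "b \<in> A" "T = op_dsum b d" using ex by metis
    have "R (a + b) (c + d) = R a c + R b d" "R (op_scaleC k a) (k * c) = op_scaleC k (R a c)"
      using st by (simp_all add: R_def P_add P_scale op_scaleC_add_left op_scaleC_add_right op_scaleC_scaleC)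
    then show "Q S \<in> dsum_complex A" "Q (S + T) = Q S + Q T" "Q (op_scaleC k S) = op_scaleC k (Q S)"
      using st by (simp_all add: Q op_dsum_add op_dsum_scale mem R_mem)
  qed
  have unit: "is_identity (dsum_complex A) (op_dsum e 1)" "Q (op_dsum e 1) = op_dsum e 1"
    using A(3) by (auto simp: is_identity_def Q R_def mem op_dsum_compose dest!: ex)
  have unit_sym: "cinner x (op_dsum e 1 y) = cinner (op_dsum e 1 x) (op_dsum e 1 y)" for x y
    using contractive_idempotent_symmetric[of e "fst x" "fst y"] eA AD(1) e_norm ee
    by (auto simp: cinner_prod_def)
  have rcp: "real_completely_positive (dsum_complex A) Q"
    unfolding real_completely_positive_def
  proof (intro allI subsetI, elim imageE)
    fix n X Y assume Y: "Y = amplification Q X" and X: "X \<in> real_positive n (dsum_complex A)"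
    note iff = real_positive_iff[OF dsum_bounded[OF AD(1)]]
    have XU: "X i j \<in> dsum_complex A" if "i < n" "j < n" for i j
      using X that by (auto simp: iff matrices_def)
    then have "\<forall>i j. \<exists>a c. i < n \<longrightarrow> j < n \<longrightarrow> a \<in> A \<and> X i j = op_dsum a c"
      using ex by blast
    then obtain a c where ac: "\<And>i j. i < n \<Longrightarrow> j < n \<Longrightarrow> a i j \<in> A \<and> X i j = op_dsum (a i j) (c i j)"
      by metis
    have pos: "0 \<le> re_form n a (\<lambda>i. fst (v i)) + scalar_form n c (\<lambda>i. snd (v i))" for v
    proof -
      have "re_form n X v = re_form n (\<lambda>i j. op_dsum (a i j) (c i j)) v"
        by (rule re_form_cong) (simp add: ac)
      moreover have "0 \<le> re_form n X v" using X by (simp add: iff)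
      ultimately show ?thesis by (simp only: re_form_op_dsum)
    qed
    have pos_a: "0 \<le> re_form n a v" for v using pos[of "\<lambda>i. (v i, 0)"] by simp
    have pos_c: "0 \<le> scalar_form n c \<mu>" for \<mu>
      using pos[of "\<lambda>i. (0, \<mu> i)"] by (simp add: re_form_def)
    have "a \<in> real_positive n A"
      using ac pos_a by (simp add: real_positive_iff[OF AD(1)] matrices_def)
    then have "amplification P a \<in> real_positive n A"
      using P(2) unfolding real_completely_positive_def by blast
    then have "0 \<le> re_form n (amplification P a) v" for v
      by (simp add: real_positive_iff[OF AD(1)])
    then have pos_R: "0 \<le> re_form n (\<lambda>i j. R (a i j) (c i j)) v" for v
      using positive_map_complement[OF A(1) P(1,2) completely_contractive_norm[OF P(3)] A(3) e_norm pos_c, of v]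
      unfolding R_def re_form_add by (simp add: amplification_def[abs_def])
    have "0 \<le> re_form n Y v" for v
    proof -
      have "re_form n Y v = re_form n (\<lambda>i j. op_dsum (R (a i j) (c i j)) (c i j)) v"
        by (rule re_form_cong) (simp add: Y amplification_def ac Q)
      then show ?thesis
        unfolding re_form_op_dsum using pos_R pos_c by (simp only: add_nonneg_nonneg)
    qed
    moreover have "Y \<in> matrices n (dsum_complex A)"
      using map XU by (auto simp: Y matrices_def amplification_def map_on_def)
    ultimately show "Y \<in> real_positive n (dsum_complex A)"
      by (simp add: iff)
  qed
  have scale: "op_scaleC k T \<in> dsum_complex A" if "T \<in> dsum_complex A" for k T
    using ex[OF that] op_dsum_scale mem AD(5) by metis
  have "completely_contractive (dsum_complex A) Q"
    by (rule unital_real_positive_contractive[OF dsum_bounded[OF AD(1)] scale map rcp unit unit_sym])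
  moreover have "Q (op_dsum a 0) = op_dsum (P a) 0" for a by (simp add: Q R_def)
  moreover have "projection_on (dsum_complex A) Q" if "projection_on A P"
    unfolding projection_on_def
  proof (intro conjI ballI map)
    fix T assume "T \<in> dsum_complex A"
    then obtain a c where a: "a \<in> A" "T = op_dsum a c" using ex by blast
    have PP: "P (P b) = P b" if "b \<in> A" for b
      using that \<open>projection_on A P\<close> by (simp add: projection_on_def)
    \<comment> \<open>Idempotence of \<open>P\<close> gives \<open>P (e - P e) = 0\<close>, so the added term is killed by \<open>P\<close>.\<close>
    have "P (e - P e) + P (P e) = P e"
      using P_add[of "e - P e" "P e"] AD(7) eA P_mem by simp
    then have "P (e - P e) = 0" by (simp add: PP eA)
    then have "R (R a c) c = R a c"
      unfolding R_def[of a c] using P_add[of "P a" "op_scaleC c (e - P e)"] a(1) eA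
      by (simp add: R_def P_scale P_mem AD(5,7) PP op_scaleC_zero_right)
    then show "Q (Q T) = Q T" by (simp add: Q a(2))
  qed
  ultimately show ?thesis
    using map rcp unit by (auto simp: unital_on_def)
qed

theorem proposition2p2:
  fixes A :: "('h::chilbert_space \<Rightarrow>\<^sub>L 'h) set"
    and P :: "('h \<Rightarrow>\<^sub>L 'h) \<Rightarrow> 'h \<Rightarrow>\<^sub>L 'h"
  assumes "operator_algebra A"
    and "approximately_unital A"
    and "map_on A P"
    and "real_completely_positive A P"
    and "completely_contractive A P"
  shows "(\<not> unital_algebra A \<longrightarrow>
      (\<exists>Q. map_on (unitization A) Q \<and>
        (\<forall>a\<in>A. Q a = P a) \<and>
        unital_on (unitization A) Q \<and>
        real_completely_positive (unitization A) Q \<and>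
        completely_contractive (unitization A) Q \<and>
        (projection_on A P \<longrightarrow> projection_on (unitization A) Q))) \<and>
    (unital_algebra A \<longrightarrow>
      (\<exists>Q. map_on (dsum_complex A) Q \<and>
        (\<forall>a\<in>A. Q (op_dsum a 0) = op_dsum (P a) 0) \<and>
        unital_on (dsum_complex A) Q \<and>
        real_completely_positive (dsum_complex A) Q \<and>
        completely_contractive (dsum_complex A) Q \<and>
        (projection_on A P \<longrightarrow> projection_on (dsum_complex A) Q)))"
proof (intro conjI impI)
  assume "unital_algebra A"
  then obtain e where "is_identity A e" by (auto simp: unital_algebra_def)
  from dsum_extension[OF assms(1,2) this assms(3-5)]
  show "\<exists>Q. map_on (dsum_complex A) Q \<and>
        (\<forall>a\<in>A. Q (op_dsum a 0) = op_dsum (P a) 0) \<and>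
        unital_on (dsum_complex A) Q \<and>
        real_completely_positive (dsum_complex A) Q \<and>
        completely_contractive (dsum_complex A) Q \<and>
        (projection_on A P \<longrightarrow> projection_on (dsum_complex A) Q)" .
qed (rule unitization_extension[OF assms(1,2) _ assms(3-5)])

end
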